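(* Let $n\ge 1$, $\gamma\in(0,1)$, $T>0$, $\tau>0$, $s>0$, $p>0$, $E>0$, $\delta>0$, and $0\le h\le 1/2$. Let $u$ be the solution of the final value problem $\partial_t^\gamma u=\Delta u$ on $\mathbb{R}^n\times(0,T)$, $u(\cdot,T)=g$, with $u(\cdot,0)\in H^p(\mathbb{R}^n)$ and $\|u(\cdot,0)\|_{H^p}\le E$; let $g^\delta\in L^2(\mathbb{R}^n)$ satisfy $\|g-g^\delta\|_{L^2}\le\delta$; let $\psi_h$ be a positive function on $[0,\infty)\times(0,T]$ such that $$\forall t\in(0,T],\qquad \left\|\frac{\psi_h(|\xi|,t)-E_{\gamma,1}(-|\xi|^2t^\gamma)}{E_{\gamma,1}(-|\xi|^2t^\gamma)}\right\|_{\infty}\le h$$ (supremum norm over $\xi\in\mathbb{R}^n$); and for $\alpha>0$ let $u_\alpha^{\delta,h}(\cdot,t)$ be defined by $\widehat{u_\alpha^{\delta,h}}(\xi,t)=e^{-\tau(\alpha|\xi|)^s}\,\dfrac{\psi_h(|\xi|,t)}{\psi_h(|\xi|,T)}\,\widehat{g^\delta}(\xi)$ for $t\in(0,T]$. Then, for the a-priori choice $\alpha(\delta,h)=(h+\delta/E)^{\frac1{p+2}}$, for all $t\in(0,T]$ and all $l\in[0,p+2]$ such that $p+2-l\le s$, $$\big\|u(\cdot,t)-u_{\alpha(\delta,h)}^{\delta,h}(\cdot,t)\big\|_{H^l}\le\frac{C}{t^\gamma}\,E^{\frac{l}{p+2}}\,(\delta+hE)^{1-\frac{l}{p+2}},$$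 where $C$ is a constant independent of $\delta$, $h$, $E$ and $t$.
   Context: The Fourier transform is $\widehat f(\xi)=(2\pi)^{-n/2}\int_{\mathbb{R}^n}f(x)e^{-ix\cdot\xi}\,dx$, and $\|f\|_{H^p}=\|(1+|\xi|^2)^{p/2}\widehat f\|_{L^2}$. $\partial_t^\gamma$ is the Caputo derivative $\partial_t^\gamma u(t)=\frac{1}{\Gamma(1-\gamma)}\int_0^t\frac{u'(r)}{(t-r)^\gamma}\,dr$. $E_{\gamma,1}(z)=\sum_{k\ge0}\frac{z^k}{\Gamma(\gamma k+1)}$ is the Mittag-Leffler function. A solution of $\partial_t^\gamma u=\Delta u$ is understood through its frequency representation $\widehat u(\xi,t)=\widehat u(\xi,0)\,E_{\gamma,1}(-|\xi|^2t^\gamma)$, $t\in[0,T]$ (transform in $x$); thus $\widehat g(\xi)=\widehat u(\xi,0)E_{\gamma,1}(-|\xi|^2T^\gamma)$ for $g=u(\cdot,T)$. The function $\psi_h$ models an approximate evaluation of the Mittag-Leffler function. Here $E>0$ (a bound on the Sobolev norm) is not to be confused with the function $E_{\gamma,1}$.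
   Formalization: For l>0 it is additionally assumed that δ ≤ M·E for an arbitrary fixed M, on which C may depend (nothing is added for l=0); without a bound on δ/E the claim fails for every l>0, e.g. u=g=0, h=0, g^δ of low frequency, δ→∞. *)

theory Defs
  imports "HOL-Analysis.Analysis"
begin

definition square_integrable :: "('a::euclidean_space \<Rightarrow> complex) \<Rightarrow> bool" where
  "square_integrable f \<longleftrightarrow>
     f \<in> borel_measurable lborel \<and> integrable lborel (\<lambda>x. (norm (f x))\<^sup>2)"

(* Meaningful for square-integrable functions only. *)
definition L2_norm :: "('a::euclidean_space \<Rightarrow> complex) \<Rightarrow> real" where
  "L2_norm f = sqrt (\<integral>x. (norm (f x))\<^sup>2 \<partial>lborel)"

definition fourier_integral ::
    "('a::euclidean_space \<Rightarrow> complex) \<Rightarrow> 'a \<Rightarrow> complex" where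
  "fourier_integral f \<xi> =
     complex_of_real ((2 * pi) powr (- real DIM('a) / 2)) *
       (\<integral>x. f x * exp (- (\<i> * complex_of_real (x \<bullet> \<xi>))) \<partial>lborel)"

(* The Fourier integral of a square-integrable function need not converge absolutely, so F is the
   transform of f on L2 if it is the L2 limit, as R tends to infinity, of the Fourier integrals of
   the (integrable) truncations of f to balls of radius R. The nonnegative integral makes
   divergence visible as the value infinity. F is determined up to a null set. *)
definition is_fourier_transform ::
    "('a::euclidean_space \<Rightarrow> complex) \<Rightarrow> ('a \<Rightarrow> complex) \<Rightarrow> bool" where
  "is_fourier_transform f F \<longleftrightarrow>
     square_integrable F \<and>
     ((\<lambda>R. \<integral>\<^sup>+\<xi>. ennreal ((norm (fourier_integral (\<lambda>x. if norm x \<le> R then f x else 0) \<xi>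
                              - F \<xi>))\<^sup>2) \<partial>lborel) \<longlongrightarrow> 0) at_top"

(* A representative of the L2 Fourier transform: equations for it are to be read almost everywhere. *)
definition fourier :: "('a::euclidean_space \<Rightarrow> complex) \<Rightarrow> 'a \<Rightarrow> complex" where
  "fourier f = (SOME F. is_fourier_transform f F)"

definition sobolev_weighted ::
    "real \<Rightarrow> ('a::euclidean_space \<Rightarrow> complex) \<Rightarrow> 'a \<Rightarrow> complex" where
  "sobolev_weighted p f \<xi> = complex_of_real ((1 + (norm \<xi>)\<^sup>2) powr (p / 2)) * fourier f \<xi>"

(* Intended for p >= 0, where H^p is contained in L2. *)
definition in_sobolev :: "real \<Rightarrow> ('a::euclidean_space \<Rightarrow> complex) \<Rightarrow> bool" where
  "in_sobolev p f \<longleftrightarrow> square_integrable f \<and> square_integrable (sobolev_weighted p f)"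

definition sobolev_norm :: "real \<Rightarrow> ('a::euclidean_space \<Rightarrow> complex) \<Rightarrow> real" where
  "sobolev_norm p f = L2_norm (sobolev_weighted p f)"

definition mittag_leffler :: "real \<Rightarrow> real \<Rightarrow> real \<Rightarrow> real" where
  "mittag_leffler a b z = (\<Sum>k. z ^ k / Gamma (a * real k + b))"

(* Solutions of the time-fractional equation are understood through their frequency
   representation; u t is the function u(., t), and equality of functions is almost everywhere. *)
definition final_value_solution ::
    "real \<Rightarrow> real \<Rightarrow> ('a::euclidean_space \<Rightarrow> complex) \<Rightarrow> (real \<Rightarrow> 'a \<Rightarrow> complex) \<Rightarrow> bool" where
  "final_value_solution \<gamma> T g u \<longleftrightarrow>
     square_integrable g \<and>
     (\<forall>t\<in>{0..T}. square_integrable (u t) \<and>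
        (AE \<xi> in lborel. fourier (u t) \<xi> =
           fourier (u 0) \<xi> * complex_of_real (mittag_leffler \<gamma> 1 (- ((norm \<xi>)\<^sup>2 * t powr \<gamma>))))) \<and>
     (AE x in lborel. u T x = g x)"

(* v t is the regularized solution at time t, given by its Fourier transform. *)
definition regularized_solution ::
    "real \<Rightarrow> real \<Rightarrow> real \<Rightarrow> (real \<Rightarrow> real \<Rightarrow> real) \<Rightarrow> ('a::euclidean_space \<Rightarrow> complex) \<Rightarrow> real \<Rightarrow>
     (real \<Rightarrow> 'a \<Rightarrow> complex) \<Rightarrow> bool" where
  "regularized_solution T \<tau> s \<psi> g\<^sub>\<delta> \<alpha> v \<longleftrightarrow>
     (\<forall>t\<in>{0<..T}. square_integrable (v t) \<and>
        (AE \<xi> in lborel. fourier (v t) \<xi> =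
           complex_of_real (exp (- \<tau> * (\<alpha> * norm \<xi>) powr s) * (\<psi> (norm \<xi>) t / \<psi> (norm \<xi>) T)) *
           fourier g\<^sub>\<delta> \<xi>))"

end

(*
  On the Fourier side the error is a bias term, u(0)^ times
  E(t) (1 - e^{-tau (alpha |xi|)^s} q) with a relative error |q - 1| <= 4h, plus the filtered noise
  e^{-tau (alpha |xi|)^s} psi(t)/psi(T) (g - g_delta)^.  The two-sided bound
  c / (1 + x) <= E_{gamma,1}(-x) <= C / (1 + x) shows that E(t) gains two derivatives at the price
  t^{-gamma} and that E(t) / E(T) = O(t^{-gamma}); the rest is elementary optimization in alpha.

  The Mittag-Leffler bounds need only the monotonicity of u(t) = E_{gamma,1}(-t^gamma), that is
  w = -u' >= 0.  Since u solves 1 - u = k_gamma * u and u = k_{1-gamma} * w for the kernels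
  k_a(t) = t^{a-1} / Gamma(a), monotonicity bounds u from above by the first equation and from
  below by the second one (here * is convolution).  Positivity of w follows from the resolvent
  equation w = k - k * w and the log-convexity of k = k_gamma.

  From the L2 theory of the Fourier transform only the inequality of Plancherel's theorem is needed,
  which follows by Gaussian regularization and the Schur test.
*)
theory Submission
  imports Defs "HOL-Real_Asymp.Real_Asymp" "HOL-Probability.Characteristic_Functions"
begin

section \<open>Bounds for the Mittag-Leffler function\<close>

text \<open>The Mittag-Leffler series alternates for negative arguments, so neither sign nor decay
  can be read off its terms. Integrating it termwise gives the convolution equations, and sign and
  decay are then extracted from these on the real line.

  \<open>fourier f\<close> is a chosen object and means nothing until an L2 transform is known to
  exist and to be unique almost everywhere. Existence is a Riesz-Fischer argument fed by the norm
  inequality for truncations. One direction of Plancherel suffices because Sobolev norms are already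
  integrals over frequencies: only the noise bound has to be carried from space to frequency.

  With P = p + 2 and \<kappa> = h + \<delta> / E, and up to the common factor t^(-\<gamma>), the
  filter bias is of order E \<alpha>^(P - l), the error in the Mittag-Leffler values of order at
  most max(h, \<alpha>^(P - l)) E, and the noise of order \<delta> \<alpha>^(-l). For \<alpha> =
  \<kappa>^(1/P) all of them are at most a constant times E \<kappa>^(1 - l/P), the claimed rate.
  The obstacle is low frequencies: the filter equals 1 at frequency 0, so for l > 0 the noise bound
  requires \<alpha> to stay bounded.\<close>

text \<open>Wendel's inequality, from log-convexity of Gamma: \<open>y + 1\<close> is the convex
  combination of \<open>y + g\<close> and \<open>y + g + 1\<close> with weights \<open>g\<close> and
  \<open>1 - g\<close>. It makes the ratio of consecutive Mittag-Leffler coefficients decay like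
  y^(-g), as the ratio test requires.\<close>

lemma Gamma_add_ge:
  fixes y g :: real
  assumes "0 < y" "0 < g" "g < 1"
  shows "y * (y + g) powr (g - 1) * Gamma y \<le> Gamma (y + g)"
proof -
  have pos: "Gamma (y + g) > 0" "Gamma (y + g + 1) > 0" "Gamma (y + 1) > 0"
    using assms by (auto intro!: Gamma_real_pos)
  have "(ln \<circ> Gamma) ((1 - (1 - g)) *\<^sub>R (y + g) + (1 - g) *\<^sub>R (y + g + 1)) \<le>
      (1 - (1 - g)) * (ln \<circ> Gamma) (y + g) + (1 - g) * (ln \<circ> Gamma) (y + g + 1)"
    using assms by (intro convex_onD[OF log_convex_Gamma_real]) auto
  also have "(1 - (1 - g)) *\<^sub>R (y + g) + (1 - g) *\<^sub>R (y + g + 1) = y + 1"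
    by (simp add: algebra_simps)
  finally have "ln (Gamma (y + 1)) \<le> g * ln (Gamma (y + g)) + (1 - g) * ln (Gamma (y + g + 1))"
    by simp
  also have "Gamma (y + g + 1) = (y + g) * Gamma (y + g)"
    using assms by (intro Gamma_plus1) (auto elim!: nonpos_Ints_cases')
  also have "ln \<dots> = ln (y + g) + ln (Gamma (y + g))"
    using pos assms by (intro ln_mult_pos) auto
  finally have "ln (Gamma (y + 1)) \<le> ln (Gamma (y + g)) + (1 - g) * ln (y + g)"
    by (simp add: algebra_simps)
  also have "\<dots> = ln (Gamma (y + g) * (y + g) powr (1 - g))"
    using pos assms by (simp add: ln_mult_pos ln_powr)
  finally have "Gamma (y + 1) \<le> Gamma (y + g) * (y + g) powr (1 - g)"
    using pos assms by (subst (asm) ln_le_cancel_iff) auto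
  moreover have "Gamma (y + 1) = y * Gamma y"
    using assms by (intro Gamma_plus1) (auto elim!: nonpos_Ints_cases')
  ultimately have "y * Gamma y \<le> Gamma (y + g) * (y + g) powr (1 - g)" by simp
  then have "y * Gamma y * (y + g) powr (g - 1) \<le>
      Gamma (y + g) * (y + g) powr (1 - g) * (y + g) powr (g - 1)"
    by (intro mult_right_mono) auto
  also have "\<dots> = Gamma (y + g)"
    using assms by (simp add: mult.assoc flip: powr_add)
  finally show ?thesis by (simp add: ac_simps)
qed

lemma summable_mittag_leffler:
  fixes g b x :: real
  assumes "0 < g" "g < 1" "0 < b"
  shows "summable (\<lambda>k. x ^ k / Gamma (g * real k + b))"
proof -
  have "((\<lambda>y::real. \<bar>x\<bar> * (y + g) powr (1 - g) / y) \<longlongrightarrow> 0) at_top"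
    using assms by real_asymp
  moreover have "filterlim (\<lambda>k. g * real k + b) at_top sequentially"
    using assms by real_asymp
  ultimately have "(\<lambda>k. \<bar>x\<bar> * (g * real k + b + g) powr (1 - g) / (g * real k + b)) \<longlonglongrightarrow> 0"
    by (rule filterlim_compose)
  then have "eventually (\<lambda>k. \<bar>x\<bar> * (g * real k + b + g) powr (1 - g) / (g * real k + b) < 1 / 2)
      sequentially"
    by (rule order_tendstoD) simp
  then obtain N where N: "\<And>k. k \<ge> N \<Longrightarrow>
      \<bar>x\<bar> * (g * real k + b + g) powr (1 - g) / (g * real k + b) < 1 / 2"
    unfolding eventually_sequentially by blast
  show ?thesis
  proof (rule summable_ratio_test[of "1/2"])
    fix k assume k: "k \<ge> N"
    define y where "y = g * real k + b"
    have y: "y > 0" using assms by (simp add: y_def add_nonneg_pos)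
    have G: "Gamma y > 0" "Gamma (y + g) > 0" using y assms by (auto intro!: Gamma_real_pos)
    have e: "g * real (Suc k) + b = y + g" by (simp add: y_def algebra_simps)
    have "\<bar>x\<bar> / Gamma (y + g) \<le> \<bar>x\<bar> / (y * (y + g) powr (g - 1) * Gamma y)"
      using Gamma_add_ge[of y g] assms y G by (intro divide_left_mono) auto
    also have "\<dots> = \<bar>x\<bar> * (y + g) powr (1 - g) / y / Gamma y"
      using powr_minus[of "y + g" "1 - g"] by (simp add: field_simps)
    also have "\<dots> \<le> 1 / 2 / Gamma y"
      using N[OF k] G by (intro divide_right_mono) (auto simp: y_def)
    finally have "\<bar>x\<bar> ^ k * (\<bar>x\<bar> / Gamma (y + g)) \<le> \<bar>x\<bar> ^ k * (1 / 2 / Gamma y)"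
      by (intro mult_left_mono) auto
    then show "norm (x ^ Suc k / Gamma (g * real (Suc k) + b)) \<le>
        1 / 2 * norm (x ^ k / Gamma (g * real k + b))"
      unfolding e y_def [symmetric] using G by (simp add: abs_mult power_abs field_simps)
  qed simp
qed

lemma isCont_mittag_leffler:
  fixes g b x :: real
  assumes "0 < g" "g < 1" "0 < b"
  shows "isCont (mittag_leffler g b) x"
proof -
  have "isCont (\<lambda>x. \<Sum>k. 1 / Gamma (g * real k + b) * x ^ k) x"
    using summable_mittag_leffler[OF assms]
    by (intro isCont_powser_converges_everywhere) (simp add: field_simps)
  moreover have "mittag_leffler g b = (\<lambda>x. \<Sum>k. 1 / Gamma (g * real k + b) * x ^ k)"
    by (simp add: mittag_leffler_def fun_eq_iff)
  ultimately show ?thesis by simp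
qed

lemma mittag_leffler_shift:
  fixes g b x :: real
  assumes "0 < g" "g < 1" "0 < b"
  shows "mittag_leffler g b x = 1 / Gamma b + x * mittag_leffler g (b + g) x"
proof -
  have "mittag_leffler g b x = 1 / Gamma b + (\<Sum>k. x ^ Suc k / Gamma (g * real (Suc k) + b))"
    unfolding mittag_leffler_def
    using suminf_split_head[OF summable_mittag_leffler[OF assms, of x]] by simp
  also have "(\<lambda>k. x ^ Suc k / Gamma (g * real (Suc k) + b)) =
      (\<lambda>k. x * (x ^ k / Gamma (g * real k + (b + g))))"
    by (simp add: fun_eq_iff algebra_simps)
  also have "suminf \<dots> = x * mittag_leffler g (b + g) x"
    unfolding mittag_leffler_def using assms
    by (intro suminf_mult summable_mittag_leffler) auto
  finally show ?thesis .
qed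

section \<open>Convolution identities for the Mittag-Leffler kernels\<close>

text \<open>The convolution rule k_a * k_b = k_(a+b) for power kernels, before normalization by
  Gamma factors; rescaling {0..t} to the unit interval gives the Beta integral.\<close>

lemma has_integral_Beta_scaled:
  fixes a b t :: real
  assumes "0 < a" "0 < b" "0 < t"
  shows "((\<lambda>s. (t - s) powr (a - 1) * s powr (b - 1)) has_integral
    Beta a b * t powr (a + b - 1)) {0..t}"
proof -
  have "((\<lambda>s. s powr (b - 1) * (1 - s) powr (a - 1)) has_integral Beta b a) (cbox 0 1)"
    using has_integral_Beta_real[of b a] assms by simp
  from has_integral_affinity'[OF this, of "1/t" 0] assms
  have "((\<lambda>s. (s / t) powr (b - 1) * (1 - s / t) powr (a - 1)) has_integral Beta b a * t) {0..t}"
    by (simp add: field_simps)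
  from has_integral_mult_right[OF this, of "t powr (a + b - 2)"]
  have int: "((\<lambda>s. t powr (a + b - 2) * ((s / t) powr (b - 1) * (1 - s / t) powr (a - 1)))
      has_integral t powr (a + b - 2) * (Beta b a * t)) {0..t}" .
  have "((\<lambda>s. (t - s) powr (a - 1) * s powr (b - 1)) has_integral
      t powr (a + b - 2) * (Beta b a * t)) {0..t}"
  proof (rule has_integral_eq[OF _ int])
    fix s assume s: "s \<in> {0..t}"
    have "t powr (a + b - 2) * ((s / t) powr (b - 1) * (1 - s / t) powr (a - 1)) =
        (t powr (b - 1) * (s / t) powr (b - 1)) * (t powr (a - 1) * (1 - s / t) powr (a - 1))"
      using powr_add[of t "b - 1" "a - 1"] by (simp add: algebra_simps)
    also have "t powr (b - 1) * (s / t) powr (b - 1) = s powr (b - 1)"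
      using s assms by (subst powr_mult [symmetric]) auto
    also have "t powr (a - 1) * (1 - s / t) powr (a - 1) = (t - s) powr (a - 1)"
      using s assms by (subst powr_mult [symmetric]) (auto simp: right_diff_distrib)
    finally show "t powr (a + b - 2) * ((s / t) powr (b - 1) * (1 - s / t) powr (a - 1)) =
        (t - s) powr (a - 1) * s powr (b - 1)" by simp
  qed
  also have "t powr (a + b - 2) * (Beta b a * t) = Beta a b * t powr (a + b - 1)"
    using assms powr_add[of t "a + b - 2" 1] by (simp add: Beta_commute)
  finally show ?thesis .
qed

text \<open>For \<open>b = 1\<close> this is the relaxation function, for \<open>b = g\<close> it is minus its derivative.\<close>

definition ml_kernel :: "real \<Rightarrow> real \<Rightarrow> real \<Rightarrow> real" where
  "ml_kernel g b t = t powr (b - 1) * mittag_leffler g b (- (t powr g))"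

text \<open>Fractional integration of order \<open>a\<close> acts on the series term by term: the
  Beta integral cancels Gamma (g k + b) and leaves Gamma (g k + a + b) in the denominator. Dominated
  convergence of the partial sums justifies the exchange.\<close>

lemma ml_kernel_convolution:
  fixes g a b t :: real
  assumes g: "0 < g" "g < 1" and ab: "0 < a" "0 < b" and t: "0 < t"
  shows "((\<lambda>s. (t - s) powr (a - 1) / Gamma a * ml_kernel g b s) has_integral
    ml_kernel g (a + b) t) {0..t}"
proof -
  define c where "c k = (- 1) ^ k / Gamma (g * real k + b)" for k
  define f where "f n s = (\<Sum>k<n. c k / Gamma a * ((t - s) powr (a - 1) * s powr (g * real k + b - 1)))"
    for n s
  have Ga: "Gamma a > 0" using ab by (intro Gamma_real_pos)
  have Gk: "Gamma (g * real k + b) > 0" for k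
    using ab g by (intro Gamma_real_pos) (simp add: add_nonneg_pos)
  \<comment> \<open>The series of absolute values at the right endpoint \<open>t\<close> dominates
    every partial sum on {0..t}.\<close>
  define S where "S = (\<Sum>k. (t powr g) ^ k / Gamma (g * real k + b))"
  \<comment> \<open>True at \<open>s = 0\<close> as well, since \<open>0 powr x = 0\<close> for
    every exponent \<open>x\<close>.\<close>
  have pw: "s powr (g * real k + b - 1) = s powr (b - 1) * (s powr g) ^ k" if "s \<ge> 0" for s k
  proof (cases "s = 0")
    case False
    then show ?thesis
      using that powr_add[of s "b - 1" "g * real k"] powr_powr[of s g "real k"]
      by (simp add: algebra_simps powr_realpow)
  qed simp
  have fint: "(f n has_integral (\<Sum>k<n. t powr (a + b - 1) * ((- (t powr g)) ^ k / Gamma (g * real k + (a + b))))) {0..t}"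
    for n
    unfolding f_def
  proof (intro has_integral_sum)
    fix k
    have "((\<lambda>s. (t - s) powr (a - 1) * s powr (g * real k + b - 1)) has_integral
      Beta a (g * real k + b) * t powr (a + (g * real k + b) - 1)) {0..t}"
      using ab g t by (intro has_integral_Beta_scaled) (auto simp: add_nonneg_pos)
    from has_integral_mult_right[OF this, of "c k / Gamma a"]
    have "((\<lambda>s. c k / Gamma a * ((t - s) powr (a - 1) * s powr (g * real k + b - 1))) has_integral
      c k / Gamma a * (Beta a (g * real k + b) * t powr (a + (g * real k + b) - 1))) {0..t}" .
    moreover have "t powr (a + (g * real k + b) - 1) = t powr (a + b - 1) * (t powr g) ^ k"
      using t powr_add[of t "a + b - 1" "g * real k"] powr_powr[of t g "real k"]
      by (simp add: algebra_simps powr_realpow)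
    moreover have "c k / Gamma a * (Beta a (g * real k + b) * (t powr (a + b - 1) * (t powr g) ^ k)) =
        t powr (a + b - 1) * ((- (t powr g)) ^ k / Gamma (g * real k + (a + b)))"
      using Ga Gk[of k] unfolding c_def Beta_def power_minus[of "t powr g"]
      by (simp add: field_simps)
    ultimately show "((\<lambda>s. c k / Gamma a * ((t - s) powr (a - 1) * s powr (g * real k + b - 1)))
      has_integral t powr (a + b - 1) * ((- (t powr g)) ^ k / Gamma (g * real k + (a + b)))) {0..t}"
      by simp
  qed simp
  have hint: "(\<lambda>s. S / Gamma a * ((t - s) powr (a - 1) * s powr (b - 1))) integrable_on {0..t}"
    using has_integral_Beta_scaled[of a b t] ab t
    by (intro integrable_on_mult_right) (auto simp: integrable_on_def)
  have feq: "f n s = (t - s) powr (a - 1) / Gamma a * s powr (b - 1) *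
      (\<Sum>k<n. (- (s powr g)) ^ k / Gamma (g * real k + b))" if "s \<ge> 0" for n s
    unfolding f_def sum_distrib_left c_def pw[OF that] power_minus[of "s powr g"]
    by (simp add: field_simps)
  have bound: "norm (f n s) \<le> S / Gamma a * ((t - s) powr (a - 1) * s powr (b - 1))"
    if s: "s \<in> {0..t}" for n s
  proof -
    have "norm (\<Sum>k<n. (- (s powr g)) ^ k / Gamma (g * real k + b)) \<le>
        (\<Sum>k<n. norm ((- (s powr g)) ^ k / Gamma (g * real k + b)))"
      by (rule norm_sum)
    also have "\<dots> \<le> (\<Sum>k<n. (t powr g) ^ k / Gamma (g * real k + b))"
    proof (intro sum_mono)
      fix k
      have "(s powr g) ^ k \<le> (t powr g) ^ k"
        using s g by (intro power_mono powr_mono2) auto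
      then show "norm ((- (s powr g)) ^ k / Gamma (g * real k + b)) \<le> (t powr g) ^ k / Gamma (g * real k + b)"
        using Gk[of k] by (auto simp: power_abs intro!: divide_right_mono)
    qed
    also have "\<dots> \<le> S"
      unfolding S_def using Gk g ab
      by (intro sum_le_suminf summable_mittag_leffler) (auto intro!: divide_nonneg_pos)
    finally have "norm (\<Sum>k<n. (- (s powr g)) ^ k / Gamma (g * real k + b)) \<le> S" .
    then have "((t - s) powr (a - 1) / Gamma a * s powr (b - 1)) *
        norm (\<Sum>k<n. (- (s powr g)) ^ k / Gamma (g * real k + b)) \<le>
        ((t - s) powr (a - 1) / Gamma a * s powr (b - 1)) * S"
      using Ga by (intro mult_left_mono) auto
    then show ?thesis
      using s Ga by (simp add: feq abs_mult field_simps)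
  qed
  have lim: "(\<lambda>n. f n s) \<longlonglongrightarrow> (t - s) powr (a - 1) / Gamma a * ml_kernel g b s"
    if s: "s \<in> {0..t}" for s
  proof -
    have "(\<lambda>n. (t - s) powr (a - 1) / Gamma a * s powr (b - 1) *
      (\<Sum>k<n. (- (s powr g)) ^ k / Gamma (g * real k + b))) \<longlonglongrightarrow>
      (t - s) powr (a - 1) / Gamma a * s powr (b - 1) * mittag_leffler g b (- (s powr g))"
      unfolding mittag_leffler_def using g ab
      by (intro tendsto_mult tendsto_const summable_LIMSEQ summable_mittag_leffler)
    then show ?thesis using s by (simp add: feq ml_kernel_def mult.assoc)
  qed
  have conv: "(\<lambda>s. (t - s) powr (a - 1) / Gamma a * ml_kernel g b s) integrable_on {0..t}"
    "(\<lambda>n. integral {0..t} (f n)) \<longlonglongrightarrow>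
      integral {0..t} (\<lambda>s. (t - s) powr (a - 1) / Gamma a * ml_kernel g b s)"
    using dominated_convergence[OF _ hint bound lim] fint by (auto simp: integrable_on_def)
  have "(\<lambda>n. integral {0..t} (f n)) \<longlonglongrightarrow> ml_kernel g (a + b) t"
  proof -
    have "integral {0..t} (f n) = t powr (a + b - 1) *
        (\<Sum>k<n. (- (t powr g)) ^ k / Gamma (g * real k + (a + b)))" for n
      using fint[of n] by (simp add: integral_unique sum_distrib_left)
    then show ?thesis
      unfolding ml_kernel_def mittag_leffler_def using g ab
      by (auto intro!: tendsto_mult tendsto_const summable_LIMSEQ summable_mittag_leffler)
  qed
  then have "integral {0..t} (\<lambda>s. (t - s) powr (a - 1) / Gamma a * ml_kernel g b s) = ml_kernel g (a + b) t"
    by (rule LIMSEQ_unique[OF conv(2)])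
  with conv(1) show ?thesis
    by (simp add: has_integral_integrable_integral)
qed

text \<open>Together with \<open>ml_kernel_convolution\<close> for \<open>a = g\<close> this is a
  Volterra equation k_b - f = k_g * f for f = \<open>ml_kernel g b\<close>: the integrated
  relaxation equation for \<open>b = 1\<close>, the resolvent equation for
  \<open>b = g\<close>.\<close>

lemma ml_kernel_shift:
  assumes "0 < g" "g < 1" "0 < b" "0 < t"
  shows "ml_kernel g b t = t powr (b - 1) / Gamma b - ml_kernel g (b + g) t"
  using assms powr_add[of t "b - 1" g] unfolding ml_kernel_def
  by (subst mittag_leffler_shift) (auto simp: algebra_simps)

lemma continuous_on_ml_kernel:
  assumes "0 < g" "g < 1" "0 < b"
  shows "continuous_on {0<..} (ml_kernel g b)"
proof -
  have "continuous_on UNIV (mittag_leffler g b)"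
    using isCont_mittag_leffler[OF assms] by (simp add: continuous_on_eq_continuous_at)
  then have "continuous_on {0<..} (\<lambda>t. mittag_leffler g b (- (t powr g)))"
    by (rule continuous_on_compose2) (auto intro!: continuous_intros)
  then show ?thesis
    unfolding ml_kernel_def by (intro continuous_intros) auto
qed

section \<open>Positivity and monotonicity\<close>

lemma has_integral_powr_diff:
  fixes g r t :: real
  assumes "0 < g" "r \<le> t"
  shows "((\<lambda>s. (t - s) powr (g - 1)) has_integral (t - r) powr g / g) {r..t}"
proof -
  \<comment> \<open>For \<open>g < 1\<close> the integrand is unbounded near \<open>s = t\<close>,
    but its antiderivative is continuous up to there, so the interior form of the fundamental
    theorem applies.\<close>
  have "((\<lambda>s. (t - s) powr (g - 1)) has_integral
      (- ((t - t) powr g / g)) - (- ((t - r) powr g / g))) {r..t}"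
    using assms
    by (intro fundamental_theorem_of_calculus_interior continuous_intros continuous_on_powr')
       (auto intro!: derivative_eq_intros
             simp flip: has_real_derivative_iff_has_vector_derivative)
  then show ?thesis using assms by simp
qed

text \<open>Suppose \<open>t0\<close> is the first point where \<open>w \<le> 0\<close>. The memory
  integral in k - w = k * w at \<open>t0\<close> is compared with the one at an earlier
  \<open>t'\<close>: over {0..t'} it grows at most by the factor \<open>k t0 / k t'\<close>, and
  over {t'..t0} it contributes at most \<open>w t' / 4\<close>. The term \<open>k t0\<close> cancels
  and \<open>k t0 / k t' \<le> 1 / 4\<close> remains, which is false for \<open>t'\<close> close to
  \<open>t0\<close>.\<close>

lemma ml_kernel_pos:
  assumes g: "0 < g" "g < 1" and t: "0 < t"
  shows "0 < ml_kernel g g t"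
proof (rule ccontr)
  define k where "k s = s powr (g - 1) / Gamma g" for s
  define w where "w = ml_kernel g g"
  have Gg: "Gamma g > 0" "Gamma (g + 1) > 0" using g by (auto intro!: Gamma_real_pos)
  have Gp: "Gamma (g + 1) = g * Gamma g"
    using g by (intro Gamma_plus1) (auto elim!: nonpos_Ints_cases')
  have kpos: "k s > 0" if "s > 0" for s using that Gg by (simp add: k_def)
  have cont: "continuous_on {0<..} w"
    unfolding w_def using g by (intro continuous_on_ml_kernel)
  have eqn: "((\<lambda>s. k (t - s) * w s) has_integral k t - w t) {0..t}" if "t > 0" for t
    using ml_kernel_convolution[of g g g t] ml_kernel_shift[of g g t] g that
    by (simp add: k_def w_def)
  assume "\<not> 0 < ml_kernel g g t"
  then have wt: "w t \<le> 0" by (simp add: w_def)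
  have "isCont (\<lambda>s. mittag_leffler g g (- s)) 0"
    using g by (intro isCont_o2[where f = uminus, OF _ isCont_mittag_leffler]) auto
  moreover have "0 < mittag_leffler g g (- 0)"
    using g Gg by (subst mittag_leffler_shift) auto
  ultimately have "eventually (\<lambda>s. 0 < mittag_leffler g g (- s)) (at 0)"
    unfolding isCont_def by (rule order_tendstoD)
  then obtain r where r: "r > 0" "\<And>s. 0 < s \<Longrightarrow> s < r \<Longrightarrow> 0 < mittag_leffler g g (- s)"
    unfolding eventually_at by (auto simp: dist_real_def)
  \<comment> \<open>Turns the neighbourhood of 0 in the argument \<open>s powr g\<close> of the
    Mittag-Leffler function into one in time.\<close>
  define \<eta> where "\<eta> = r powr (1 / g)"
  have eta: "\<eta> > 0" using r by (simp add: \<eta>_def)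
  have near0: "w s > 0" if "0 < s" "s < \<eta>" for s
  proof -
    have "s powr g < \<eta> powr g" using that g by (intro powr_less_mono2) auto
    also have "\<eta> powr g = r" using r g by (simp add: \<eta>_def powr_powr)
    finally show ?thesis using r that by (simp add: w_def ml_kernel_def)
  qed
  \<comment> \<open>Positivity below \<open>\<eta>\<close> keeps the search for the first
    nonpositive value away from the singularity at 0; hence \<open>Z\<close> is compact and has a
    least element.\<close>
  define Z where "Z = {s \<in> {\<eta>..t}. w s \<in> {..0}}"
  have "\<not> t < \<eta>" using near0[OF t] wt by linarith
  then have "t \<in> Z" using wt by (simp add: Z_def)
  moreover have "compact Z"
  proof -
    have "continuous_on {\<eta>..t} w" using eta by (intro continuous_on_subset[OF cont]) auto
    then have "closed ({\<eta>..t} \<inter> w -` {..0})"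
      by (rule continuous_closed_preimage) auto
    also have "{\<eta>..t} \<inter> w -` {..0} = Z" by (auto simp: Z_def)
    finally have "closed Z" .
    then have "compact ({\<eta>..t} \<inter> Z)" by (intro compact_Int_closed) auto
    also have "{\<eta>..t} \<inter> Z = Z" by (auto simp: Z_def)
    finally show ?thesis .
  qed
  ultimately obtain t0 where t0: "t0 \<in> Z" "\<And>s. s \<in> Z \<Longrightarrow> t0 \<le> s"
    using compact_attains_inf[of Z] by blast
  have t0pos: "t0 > 0" and wt0: "w t0 \<le> 0" using t0 eta by (auto simp: Z_def)
  have wpos: "w s > 0" if "0 < s" "s < t0" for s
  proof (cases "s < \<eta>")
    case False
    have "s \<notin> Z" using t0(2)[of s] that by auto
    then show ?thesis using False that t0(1) by (auto simp: Z_def)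
  qed (use near0 that in blast)
  \<comment> \<open>Chosen so that the kernel has mass d^g / Gamma (g + 1) = 1/4 over a time of
    length \<open>d\<close>.\<close>
  define d where "d = (Gamma (g + 1) / 4) powr (1 / g)"
  have d: "d > 0" "d powr g = Gamma (g + 1) / 4"
    using Gg(2) less_imp_neq[OF Gg(2)] g by (simp_all add: d_def powr_powr del: Gamma_eq_zero_iff)
  \<comment> \<open>Distance at most \<open>d\<close> from \<open>t0\<close> serves the bound on the
    short interval; staying above \<open>t0 / 2\<close> keeps the ratio \<open>k t0 / k t'\<close>
    at least 1/2.\<close>
  define t1 where "t1 = max (t0 / 2) (t0 - d)"
  have t1: "0 < t1" "t1 < t0" "t0 / 2 \<le> t1" "t0 - d \<le> t1"
    using t0pos d by (auto simp: t1_def)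
  have "continuous_on {t1..t0} w"
    using t1 by (intro continuous_on_subset[OF cont]) auto
  from continuous_attains_sup[OF _ _ this] t1
  obtain t' where t': "t' \<in> {t1..t0}" "\<And>s. s \<in> {t1..t0} \<Longrightarrow> w s \<le> w t'"
    by auto
  have wt': "w t' > 0" using t'(2)[of t1] wpos[of t1] t1 by auto
  then have t'lt: "t' < t0" "0 < t'" using t' wt0 t1 by (auto simp: less_le)
  have full: "((\<lambda>s. k (t0 - s) * w s) has_integral k t0 - w t0) {0..t0}"
    using eqn t0pos by blast
  then have int: "(\<lambda>s. k (t0 - s) * w s) integrable_on {0..t0}" by (auto simp: integrable_on_def)
  have int1: "(\<lambda>s. k (t0 - s) * w s) integrable_on {0..t'}"
    and int2: "(\<lambda>s. k (t0 - s) * w s) integrable_on {t'..t0}"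
    by (rule integrable_subinterval_real[OF int]; use t'lt in auto)+
  have split: "integral {0..t'} (\<lambda>s. k (t0 - s) * w s) + integral {t'..t0} (\<lambda>s. k (t0 - s) * w s) = k t0 - w t0"
    using Henstock_Kurzweil_Integration.integral_combine[OF _ _ int, of t'] t'lt full by (simp add: integral_unique)
  \<comment> \<open>Log-convexity of the kernel: \<open>k (t0 - s) / k (t' - s)\<close> is largest at \<open>s = 0\<close>. Together with the
    resolvent equation at the first zero \<open>t0\<close>, this bounds \<open>w t'\<close> by an integral over the short
    interval from \<open>t'\<close> to \<open>t0\<close>, where \<open>t'\<close> maximizes \<open>w\<close>.\<close>
  have "integral {0..t'} (\<lambda>s. k (t0 - s) * w s) \<le> k t0 / k t' * (k t' - w t')"
  proof (rule has_integral_le)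
    \<comment> \<open>The endpoint \<open>s = t'\<close> has to be removed: there
      \<open>k (t' - s) = k 0 = 0\<close>, since a power of 0 is 0, and the comparison of integrands
      fails.\<close>
    show "((\<lambda>s. k (t0 - s) * w s) has_integral integral {0..t'} (\<lambda>s. k (t0 - s) * w s)) {0<..<t'}"
      using integrable_integral[OF int1] by (simp flip: has_integral_Icc_iff_Ioo)
    show "((\<lambda>s. k t0 / k t' * (k (t' - s) * w s)) has_integral k t0 / k t' * (k t' - w t')) {0<..<t'}"
      using eqn[OF t'lt(2)]
      by (intro has_integral_mult_right) (simp flip: has_integral_Icc_iff_Ioo)
    fix s assume s: "s \<in> {0<..<t'}"
    have "((t0 - s) * t') powr (g - 1) \<le> (t0 * (t' - s)) powr (g - 1)"
      using s t'lt g t0pos mult_strict_left_mono[of t' t0 s]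
      by (intro powr_mono2') (auto simp: algebra_simps)
    then have "k (t0 - s) * k t' \<le> k t0 * k (t' - s)"
      using s t'lt t0pos Gg by (simp add: k_def powr_mult divide_right_mono)
    then have "k (t0 - s) \<le> k t0 / k t' * k (t' - s)"
      using kpos[OF t'lt(2)] by (simp add: field_simps)
    then have "k (t0 - s) * w s \<le> k t0 / k t' * k (t' - s) * w s"
      using wpos[of s] s t'lt by (intro mult_right_mono) auto
    then show "k (t0 - s) * w s \<le> k t0 / k t' * (k (t' - s) * w s)"
      by (simp only: mult.assoc)
  qed
  moreover have "integral {t'..t0} (\<lambda>s. k (t0 - s) * w s) \<le> w t' / 4"
  proof -
    have "integral {t'..t0} (\<lambda>s. k (t0 - s) * w s) \<le> w t' / Gamma g * ((t0 - t') powr g / g)"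
    proof (rule has_integral_le)
      show "((\<lambda>s. k (t0 - s) * w s) has_integral integral {t'..t0} (\<lambda>s. k (t0 - s) * w s)) {t'..t0}"
        using int2 by (rule integrable_integral)
      show "((\<lambda>s. w t' / Gamma g * (t0 - s) powr (g - 1)) has_integral w t' / Gamma g * ((t0 - t') powr g / g)) {t'..t0}"
        using g t'lt by (intro has_integral_mult_right has_integral_powr_diff) auto
      fix s assume s: "s \<in> {t'..t0}"
      have "(t0 - s) powr (g - 1) / Gamma g * w s \<le> (t0 - s) powr (g - 1) / Gamma g * w t'"
        using t'(2)[of s] s t' Gg by (intro mult_left_mono) auto
      then show "k (t0 - s) * w s \<le> w t' / Gamma g * (t0 - s) powr (g - 1)"
        by (simp add: k_def field_simps)
    qed
    also have "\<dots> \<le> w t' / Gamma g * (d powr g / g)"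
      using t' t1 t'lt g wt' Gg by (intro mult_left_mono divide_right_mono powr_mono2) auto
    also have "w t' / Gamma g * (d powr g / g) = w t' / 4"
      using g less_imp_neq[OF Gg(1)] by (simp add: d(2) Gp del: Gamma_eq_zero_iff)
    finally show ?thesis .
  qed
  ultimately have "k t0 - w t0 \<le> k t0 / k t' * (k t' - w t') + w t' / 4"
    using split by linarith
  then have "k t0 / k t' * w t' \<le> w t' / 4"
    using kpos[OF t'lt(2)] wt0 by (simp add: right_diff_distrib)
  then have "k t0 / k t' * w t' \<le> 1 / 4 * w t'" by simp
  then have "k t0 / k t' \<le> 1 / 4" using wt' by (rule mult_right_le_imp_le)
  moreover have "k t0 / k t' \<ge> 1 / 2"
  proof -
    have "(1 / 2 :: real) = (1/2) powr 1" by simp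
    also have "\<dots> \<le> (1/2) powr (1 - g)" using g by (intro powr_mono') auto
    also have "\<dots> \<le> (t' / t0) powr (1 - g)"
      using g t' t1 t0pos by (intro powr_mono2) (auto simp: field_simps)
    also have "\<dots> = k t0 / k t'"
      using Gg t'lt t0pos powr_minus[of t0 "1-g"] powr_minus[of t' "1-g"]
      by (simp add: k_def powr_divide field_simps)
    finally show ?thesis .
  qed
  ultimately show False by linarith
qed

text \<open>The relation w = -u' in integrated form, obtained from convolution with the constant
  kernel k_1 rather than by differentiating the series. The interval is open because
  \<open>(t - s) powr 0\<close> is 0 instead of 1 at \<open>s = t\<close>.\<close>

lemma ml_kernel_1:
  assumes "0 < g" "g < 1" "0 < t"
  shows "(ml_kernel g g has_integral 1 - ml_kernel g 1 t) {0<..<t}"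
proof -
  have "((\<lambda>s. (t - s) powr (1 - 1) / Gamma 1 * ml_kernel g g s) has_integral
      ml_kernel g (1 + g) t) {0<..<t}"
    using ml_kernel_convolution[of g 1 g t] assms by (simp flip: has_integral_Icc_iff_Ioo)
  then have "((\<lambda>s. ml_kernel g g s) has_integral ml_kernel g (1 + g) t) {0<..<t}"
    by (rule has_integral_eq [rotated]) simp
  then show ?thesis using ml_kernel_shift[of g 1 t] assms by simp
qed

lemma ml_kernel_antimono:
  assumes "0 < g" "g < 1" "0 < r" "r \<le> t"
  shows "ml_kernel g 1 t \<le> ml_kernel g 1 r"
proof -
  have "1 - ml_kernel g 1 r \<le> 1 - ml_kernel g 1 t"
  proof (rule has_integral_subset_le)
    show "(ml_kernel g g has_integral 1 - ml_kernel g 1 r) {0<..<r}"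
      "(ml_kernel g g has_integral 1 - ml_kernel g 1 t) {0<..<t}"
      using assms by (auto intro!: ml_kernel_1)
    show "{0<..<r} \<subseteq> {0<..<t}" using assms by auto
    show "\<forall>s\<in>{0<..<t}. 0 \<le> ml_kernel g g s"
      using ml_kernel_pos[of g] assms by (simp add: less_imp_le)
  qed
  then show ?thesis by simp
qed

section \<open>Two-sided bounds\<close>

text \<open>In u = k_(1-g) * w with w positive, the kernel is replaced by its smallest value t^(-g)
  / Gamma (1 - g) on the interval. As w integrates to 1 - u(t), the result is a linear inequality
  for u(t), which is solved at t^g = x.\<close>

lemma mittag_leffler_lower_bound:
  fixes g x :: real
  assumes g: "0 < g" "g < 1" and x: "0 \<le> x"
  shows "1 / (1 + Gamma (1 - g) * x) \<le> mittag_leffler g 1 (- x)"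
proof (cases "x = 0")
  case True
  then show ?thesis using mittag_leffler_shift[of g 1 0] g by simp
next
  case False
  define t where "t = x powr (1 / g)"
  have t: "t > 0" "t powr g = x" using False x g by (auto simp: t_def powr_powr)
  have u: "ml_kernel g 1 t = mittag_leffler g 1 (- x)" using t by (simp add: ml_kernel_def)
  have G: "Gamma (1 - g) > 0" using g by (intro Gamma_real_pos) auto
  have "t powr (- g) / Gamma (1 - g) * (1 - ml_kernel g 1 t) \<le> ml_kernel g 1 t"
  proof (rule has_integral_le)
    show "((\<lambda>s. t powr (- g) / Gamma (1 - g) * ml_kernel g g s) has_integral
        t powr (- g) / Gamma (1 - g) * (1 - ml_kernel g 1 t)) {0<..<t}"
      using g t by (intro has_integral_mult_right ml_kernel_1)
    show "((\<lambda>s. (t - s) powr (- g) / Gamma (1 - g) * ml_kernel g g s) has_integral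
        ml_kernel g 1 t) {0<..<t}"
      using ml_kernel_convolution[of g "1 - g" g t] g t by (simp flip: has_integral_Icc_iff_Ioo)
    fix s assume "s \<in> {0<..<t}"
    then show "t powr (- g) / Gamma (1 - g) * ml_kernel g g s \<le>
        (t - s) powr (- g) / Gamma (1 - g) * ml_kernel g g s"
      using g t ml_kernel_pos[of g s] G
      by (intro mult_right_mono divide_right_mono powr_mono2') auto
  qed
  then have "1 / (x * Gamma (1 - g)) * (1 - mittag_leffler g 1 (- x)) \<le> mittag_leffler g 1 (- x)"
    using t by (simp add: u powr_minus field_simps)
  moreover have "x * Gamma (1 - g) > 0" using G x False by simp
  ultimately have "1 - mittag_leffler g 1 (- x) \<le> mittag_leffler g 1 (- x) * (x * Gamma (1 - g))"
    by (simp add: field_simps)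
  then show ?thesis
    using \<open>x * Gamma (1 - g) > 0\<close> by (simp add: field_simps add_pos_pos)
qed

text \<open>In 1 - u = k_g * u the decreasing u is replaced by its final value u(t). The kernel has
  mass t^g / Gamma (1 + g), and the linear inequality for u(t) is solved at t^g = x.\<close>

lemma mittag_leffler_upper_bound:
  fixes g x :: real
  assumes g: "0 < g" "g < 1" and x: "0 \<le> x"
  shows "mittag_leffler g 1 (- x) \<le> 1 / (1 + x / Gamma (1 + g))"
proof (cases "x = 0")
  case True
  then show ?thesis using mittag_leffler_shift[of g 1 0] g by simp
next
  case False
  define t where "t = x powr (1 / g)"
  have t: "t > 0" "t powr g = x" using False x g by (auto simp: t_def powr_powr)
  have u: "ml_kernel g 1 t = mittag_leffler g 1 (- x)" using t by (simp add: ml_kernel_def)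
  have G: "Gamma (1 + g) > 0" "Gamma g > 0" using g by (auto intro!: Gamma_real_pos)
  have "ml_kernel g 1 t / Gamma g * ((t - 0) powr g / g) \<le> 1 - ml_kernel g 1 t"
  proof (rule has_integral_le)
    show "((\<lambda>s. ml_kernel g 1 t / Gamma g * (t - s) powr (g - 1)) has_integral
        ml_kernel g 1 t / Gamma g * ((t - 0) powr g / g)) {0<..<t}"
      using g t has_integral_powr_diff[of g 0 t]
      by (intro has_integral_mult_right) (simp flip: has_integral_Icc_iff_Ioo)
    show "((\<lambda>s. (t - s) powr (g - 1) / Gamma g * ml_kernel g 1 s) has_integral
        1 - ml_kernel g 1 t) {0<..<t}"
      using ml_kernel_convolution[of g g 1 t] ml_kernel_shift[of g 1 t] g t
      by (simp add: add.commute flip: has_integral_Icc_iff_Ioo)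
    fix s assume s: "s \<in> {0<..<t}"
    have "(t - s) powr (g - 1) / Gamma g * ml_kernel g 1 t \<le>
        (t - s) powr (g - 1) / Gamma g * ml_kernel g 1 s"
      using s g t G ml_kernel_antimono[of g s t] by (intro mult_left_mono) auto
    then show "ml_kernel g 1 t / Gamma g * (t - s) powr (g - 1) \<le>
        (t - s) powr (g - 1) / Gamma g * ml_kernel g 1 s" by (simp add: field_simps)
  qed
  moreover have "Gamma (1 + g) = g * Gamma g"
    unfolding add.commute[of 1 g] using g by (intro Gamma_plus1) (auto elim!: nonpos_Ints_cases')
  ultimately have "mittag_leffler g 1 (- x) * x / Gamma (1 + g) \<le> 1 - mittag_leffler g 1 (- x)"
    using t g by (simp add: u field_simps)
  then show ?thesis
    using G x by (simp add: field_simps add_pos_nonneg)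
qed

section \<open>The Fourier transform on L2\<close>

lemma integral_lborel_prod:
  fixes f :: "'a::euclidean_space \<Rightarrow> real \<Rightarrow> complex"
  assumes "\<And>b. b \<in> Basis \<Longrightarrow> integrable lborel (f b)"
  shows "(\<integral>x. (\<Prod>b\<in>Basis. f b (x \<bullet> b)) \<partial>lborel) = (\<Prod>b\<in>Basis. \<integral>x. f b x \<partial>lborel)"
    and "integrable lborel (\<lambda>x::'a. \<Prod>b\<in>Basis. f b (x \<bullet> b))"
proof -
  interpret product_sigma_finite "\<lambda>_::'a. lborel::real measure"
    by standard
  have [measurable]: "f b \<in> borel_measurable borel" if "b \<in> Basis" for b
    using assms[OF that] by (auto dest: borel_measurable_integrable)
  have "(\<integral>x. (\<Prod>b\<in>Basis. f b (x \<bullet> b)) \<partial>lborel) =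
      (\<integral>x. (\<Prod>b\<in>Basis. f b (x b)) \<partial>(\<Pi>\<^sub>M b\<in>(Basis::'a set). lborel))"
    by (subst lborel_eq, subst integral_distr) (auto intro!: Bochner_Integration.integral_cong prod.cong)
  also have "\<dots> = (\<Prod>b\<in>Basis. \<integral>x. f b x \<partial>lborel)"
    using assms by (intro product_integral_prod) auto
  finally show "(\<integral>x. (\<Prod>b\<in>Basis. f b (x \<bullet> b)) \<partial>lborel) = (\<Prod>b\<in>Basis. \<integral>x. f b x \<partial>lborel)" .
  have "integrable (\<Pi>\<^sub>M b\<in>(Basis::'a set). lborel) (\<lambda>x. \<Prod>b\<in>Basis. f b (x b))"
    using assms by (intro product_integrable_prod) auto
  then show "integrable lborel (\<lambda>x::'a. \<Prod>b\<in>Basis. f b (x \<bullet> b))"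
    by (subst lborel_eq, subst integrable_distr_eq) (auto cong: prod.cong)
qed

text \<open>The substitution of \<open>sqrt e * x\<close> reduces the integral to the characteristic
  function of the standard normal distribution at \<open>- w / sqrt e\<close>.\<close>

lemma fourier_gaussian_1d:
  fixes e w :: real
  assumes "0 < e"
  shows "integrable lborel (\<lambda>x. complex_of_real (exp (- (e * x\<^sup>2 / 2))) * exp (- (\<i> * complex_of_real (w * x))))"
    and "(\<integral>x. complex_of_real (exp (- (e * x\<^sup>2 / 2))) * exp (- (\<i> * complex_of_real (w * x))) \<partial>lborel) =
      complex_of_real (sqrt (2 * pi / e) * exp (- (w\<^sup>2 / (2 * e))))"
proof -
  define t where "t = - w / sqrt e"
  define f where "f x = complex_of_real (std_normal_density x) * exp (\<i> * complex_of_real (t * x))" for x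
  have [measurable]: "f \<in> borel_measurable borel" unfolding f_def by measurable
  have "integrable lborel (\<lambda>x. std_normal_density x)" by simp
  then have int: "integrable lborel f"
    by (rule Bochner_Integration.integrable_bound) (auto simp: f_def norm_mult)
  have "exp (- t\<^sup>2 / 2) = char std_normal_distribution t"
    using char_std_normal_distribution by simp
  also have "\<dots> = integral\<^sup>L lborel f"
    unfolding char_def f_def
    by (subst integral_density) (auto simp: scaleR_conv_of_real)
  also have "\<dots> = sqrt e *\<^sub>R (\<integral>x. f (0 + sqrt e * x) \<partial>lborel)"
    using assms by (subst lborel_integral_real_affine[of "sqrt e" f 0]) auto
  finally have eq: "complex_of_real (exp (- t\<^sup>2 / 2)) = sqrt e *\<^sub>R (\<integral>x. f (sqrt e * x) \<partial>lborel)" by simp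
  have fe: "f (sqrt e * x) = complex_of_real (1 / sqrt (2 * pi)) *
      (complex_of_real (exp (- (e * x\<^sup>2 / 2))) * exp (- (\<i> * complex_of_real (w * x))))" for x
    using assms unfolding f_def std_normal_density_def t_def by (simp add: power_mult_distrib)
  have "integrable lborel (\<lambda>x. f (0 + sqrt e * x))"
    using assms int by (intro lborel_integrable_real_affine) auto
  then have "integrable lborel (\<lambda>x. complex_of_real (sqrt (2 * pi)) * f (sqrt e * x))" by simp
  then show "integrable lborel (\<lambda>x. complex_of_real (exp (- (e * x\<^sup>2 / 2))) * exp (- (\<i> * complex_of_real (w * x))))"
    by (simp add: fe)
  from eq have "complex_of_real (exp (- t\<^sup>2 / 2)) = complex_of_real (sqrt e / sqrt (2 * pi)) *
      (\<integral>x. complex_of_real (exp (- (e * x\<^sup>2 / 2))) * exp (- (\<i> * complex_of_real (w * x))) \<partial>lborel)"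
    (is "_ = _ * ?I") unfolding fe by (simp add: scaleR_conv_of_real)
  then have "?I = complex_of_real (sqrt (2 * pi) / sqrt e) * complex_of_real (exp (- t\<^sup>2 / 2))"
    using assms by (simp add: field_simps)
  also have "\<dots> = complex_of_real (sqrt (2 * pi / e) * exp (- (w\<^sup>2 / (2 * e))))"
    using assms by (simp add: t_def real_sqrt_divide power_divide mult.commute)
  finally show "?I = complex_of_real (sqrt (2 * pi / e) * exp (- (w\<^sup>2 / (2 * e))))" .
qed

lemma fourier_gaussian:
  fixes w :: "'a::euclidean_space"
  assumes "0 < e"
  shows "integrable lborel (\<lambda>x::'a. complex_of_real (exp (- (e * (norm x)\<^sup>2 / 2))) * exp (- (\<i> * complex_of_real (w \<bullet> x))))"
      (is ?A)
    and "(\<integral>x. complex_of_real (exp (- (e * (norm x)\<^sup>2 / 2))) * exp (- (\<i> * complex_of_real (w \<bullet> x))) \<partial>lborel) =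
      complex_of_real (sqrt (2 * pi / e) ^ DIM('a) * exp (- ((norm w)\<^sup>2 / (2 * e))))" (is ?B)
proof -
  have nsq: "(norm x)\<^sup>2 = (\<Sum>b\<in>Basis. (x \<bullet> b)\<^sup>2)" for x :: 'a
    unfolding power2_norm_eq_inner euclidean_inner[of x x] by (simp add: power2_eq_square)
  have prod: "complex_of_real (exp (- (e * (norm x)\<^sup>2 / 2))) * exp (- (\<i> * complex_of_real (w \<bullet> x))) =
      (\<Prod>b\<in>Basis. complex_of_real (exp (- (e * (x \<bullet> b)\<^sup>2 / 2))) * exp (- (\<i> * complex_of_real ((w \<bullet> b) * (x \<bullet> b)))))" for x
    unfolding nsq euclidean_inner[of w x] prod.distrib
    by (simp add: sum_distrib_left sum_divide_distrib exp_sum flip: sum_negf of_real_prod)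
  show ?A
    unfolding prod by (rule integral_lborel_prod(2)) (intro fourier_gaussian_1d assms)
  have "(\<integral>x. complex_of_real (exp (- (e * (norm x)\<^sup>2 / 2))) * exp (- (\<i> * complex_of_real (w \<bullet> x))) \<partial>lborel) =
      (\<Prod>b\<in>Basis. complex_of_real (sqrt (2 * pi / e) * exp (- ((w \<bullet> b)\<^sup>2 / (2 * e)))))"
    unfolding prod
    by (subst integral_lborel_prod(1)) (intro fourier_gaussian_1d assms prod.cong refl)+
  also have "\<dots> = complex_of_real (sqrt (2 * pi / e) ^ DIM('a) * exp (- ((norm w)\<^sup>2 / (2 * e))))"
    unfolding nsq of_real_prod [symmetric] prod.distrib
    by (simp add: sum_divide_distrib exp_sum flip: sum_negf)
  finally show ?B .
qed

lemma nn_integral_gaussian: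
  assumes "0 < e"
  shows "(\<integral>\<^sup>+x. ennreal (exp (- ((norm (x::'a::euclidean_space))\<^sup>2 / (2 * e)))) \<partial>lborel) =
    ennreal (sqrt (2 * pi * e) ^ DIM('a))"
proof -
  have int: "integrable lborel (\<lambda>x::'a. complex_of_real (exp (- (1 / e * (norm x)\<^sup>2 / 2))))"
    using fourier_gaussian(1)[of "1/e" "0::'a"] assms by simp
  have "complex_of_real (\<integral>x. exp (- (1 / e * (norm (x::'a))\<^sup>2 / 2)) \<partial>lborel) =
      complex_of_real (sqrt (2 * pi / (1 / e)) ^ DIM('a))"
    using fourier_gaussian(2)[of "1/e" "0::'a"] assms
    by (simp flip: integral_complex_of_real)
  then have "(\<integral>x. exp (- (1 / e * (norm (x::'a))\<^sup>2 / 2)) \<partial>lborel) = sqrt (2 * pi / (1 / e)) ^ DIM('a)"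
    by (simp only: of_real_eq_iff)
  moreover have "integrable lborel (\<lambda>x::'a. exp (- (1 / e * (norm x)\<^sup>2 / 2)))"
    using int by (simp only: complex_of_real_integrable_eq)
  ultimately show ?thesis
    by (subst nn_integral_eq_integral) (auto simp: ac_simps)
qed

section \<open>The norm inequality for integrable functions\<close>

text \<open>For a non-integrable function the left-hand side is 0, the default value of the Bochner
  integral.\<close>

lemma ennreal_norm_integral_le:
  fixes f :: "_ \<Rightarrow> 'b::{banach, second_countable_topology}"
  shows "ennreal (norm (integral\<^sup>L M f)) \<le> (\<integral>\<^sup>+x. ennreal (norm (f x)) \<partial>M)"
  using integral_norm_bound_ennreal[of M f]
  by (cases "integrable M f") (auto simp: not_integrable_integral_eq)

text \<open>Fatou's lemma, in the form in which bounds on integrals survive an almost everywhere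
  limit.\<close>

lemma nn_integral_le_limit:
  fixes u :: "nat \<Rightarrow> 'b \<Rightarrow> ennreal"
  assumes [measurable]: "\<And>n. u n \<in> borel_measurable M"
    and lim: "AE x in M. (\<lambda>n. u n x) \<longlonglongrightarrow> v x"
    and bound: "eventually (\<lambda>n. (\<integral>\<^sup>+x. u n x \<partial>M) \<le> B) sequentially"
  shows "(\<integral>\<^sup>+x. v x \<partial>M) \<le> B"
proof -
  have "(\<integral>\<^sup>+x. v x \<partial>M) = (\<integral>\<^sup>+x. liminf (\<lambda>n. u n x) \<partial>M)"
    using lim by (intro nn_integral_cong_AE) (auto elim!: eventually_mono dest: lim_imp_Liminf[rotated])
  also have "\<dots> \<le> liminf (\<lambda>n. \<integral>\<^sup>+x. u n x \<partial>M)"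
    by (rule nn_integral_liminf) simp
  also have "\<dots> \<le> limsup (\<lambda>n. \<integral>\<^sup>+x. u n x \<partial>M)"
    by (rule Liminf_le_Limsup) simp
  also have "\<dots> \<le> B" using bound by (rule Limsup_bounded)
  finally show ?thesis .
qed

text \<open>For an exponential kernel this is the multiplication formula of Fourier analysis; |Q x|
  |P y| is an integrable majorant on the product.\<close>

lemma bounded_kernel_Fubini:
  fixes P Q :: "'a::euclidean_space \<Rightarrow> complex" and K :: "'a \<Rightarrow> 'a \<Rightarrow> complex"
  assumes P: "integrable lborel P" and Q: "integrable lborel Q"
    and K [measurable]: "case_prod K \<in> borel_measurable (borel \<Otimes>\<^sub>M borel)"
    and K1: "\<And>x y. norm (K x y) \<le> 1"
  shows "(\<integral>y. P y * (\<integral>x. Q x * K x y \<partial>lborel) \<partial>lborel) =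
    (\<integral>x. Q x * (\<integral>y. P y * K x y \<partial>lborel) \<partial>lborel)"
proof -
  have [measurable]: "P \<in> borel_measurable borel" "Q \<in> borel_measurable borel"
    using P Q by (auto dest: borel_measurable_integrable)
  have "integrable (lborel \<Otimes>\<^sub>M lborel) (\<lambda>(x, y). norm (Q x) * norm (P y))"
    by (rule lborel_pair.Fubini_integrable) (use P Q in auto)
  then have "integrable (lborel \<Otimes>\<^sub>M lborel) (\<lambda>(x, y). Q x * P y * K x y)"
  proof (rule Bochner_Integration.integrable_bound)
    show "AE z in lborel \<Otimes>\<^sub>M lborel. norm (case z of (x, y) \<Rightarrow> Q x * P y * K x y) \<le>
        norm (case z of (x, y) \<Rightarrow> norm (Q x) * norm (P y))"
      using K1 by (intro AE_I2) (auto simp: norm_mult split: prod.split intro!: mult_left_le)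
  qed measurable
  then have "(\<integral>y. (\<integral>x. Q x * P y * K x y \<partial>lborel) \<partial>lborel) =
      (\<integral>x. (\<integral>y. Q x * P y * K x y \<partial>lborel) \<partial>lborel)"
    by (rule lborel_pair.Fubini_integral)
  moreover have "(\<integral>x. Q x * P y * K x y \<partial>lborel) = P y * (\<integral>x. Q x * K x y \<partial>lborel)" for y
    by (subst integral_mult_right_zero [symmetric]) (simp add: ac_simps)
  moreover have "(\<integral>y. Q x * P y * K x y \<partial>lborel) = Q x * (\<integral>y. P y * K x y \<partial>lborel)" for x
    by (simp add: mult.assoc)
  ultimately show ?thesis by (simp only:)
qed

text \<open>With a Gaussian weight G and its transform H, the weighted integral of |F|^2 equals the
  double integral of f(x) cnj(f(y)) H(x - y). H is nonnegative with total mass (2 pi)^n whatever the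
  width of G, so the Schur test bounds this by (2 pi)^n times the integral of |f|^2, and the weight
  can be let tend to 1.\<close>

lemma fourier_integral_bessel:
  fixes f :: "'a::euclidean_space \<Rightarrow> complex"
  assumes f: "integrable lborel f"
  shows "(\<integral>\<^sup>+\<xi>. ennreal ((norm (fourier_integral f \<xi>))\<^sup>2) \<partial>lborel) \<le>
    (\<integral>\<^sup>+x. ennreal ((norm (f x))\<^sup>2) \<partial>lborel)"
proof -
  define n where "n = DIM('a)"
  define K where "K x \<xi> = exp (- (\<i> * complex_of_real (x \<bullet> \<xi>)))" for x \<xi> :: 'a
  define F where "F \<xi> = (\<integral>x. f x * K x \<xi> \<partial>lborel)" for \<xi>
  define N where "N = (\<integral>\<^sup>+x. ennreal ((norm (f x))\<^sup>2) \<partial>lborel)"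
  have [measurable]: "f \<in> borel_measurable borel"
    using f by (auto dest: borel_measurable_integrable)
  have Km [measurable]: "case_prod K \<in> borel_measurable (borel \<Otimes>\<^sub>M borel)"
    unfolding K_def by measurable
  have K1: "norm (K x \<xi>) = 1" for x \<xi> by (simp add: K_def)
  have F_meas [measurable]: "F \<in> borel_measurable borel"
    unfolding F_def by measurable
  have Fc_meas [measurable]: "(\<lambda>\<xi>. cnj (F \<xi>)) \<in> borel_measurable borel"
    by (intro measurable_compose[OF F_meas] borel_measurable_continuous_onI continuous_intros)
  define B where "B = (\<integral>x. norm (f x) \<partial>lborel)"
  have [simp]: "0 \<le> B" by (simp add: B_def)
  have F_bound: "norm (F \<xi>) \<le> B" for \<xi>
    unfolding F_def B_def by (rule order_trans[OF integral_norm_bound]) (simp add: norm_mult K1)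
  have main: "(\<integral>\<^sup>+\<xi>. ennreal ((norm (F \<xi>))\<^sup>2 * exp (- (e * (norm \<xi>)\<^sup>2 / 2))) \<partial>lborel) \<le>
      ennreal ((2 * pi) ^ n) * N" if e: "e > 0" for e
  proof -
    \<comment> \<open>At this point \<open>F\<close> is only known to be bounded; the weight
      supplies the integrability that Fubini needs.\<close>
    define G where "G \<xi> = exp (- (e * (norm \<xi>)\<^sup>2 / 2))" for \<xi> :: 'a
    have [measurable]: "G \<in> borel_measurable borel" unfolding G_def by measurable
    have [measurable]: "(\<lambda>\<xi>. complex_of_real (G \<xi>)) \<in> borel_measurable borel"
      unfolding G_def by measurable
    have Gc: "integrable lborel (\<lambda>\<xi>. complex_of_real (G \<xi>))"
      using fourier_gaussian(1)[OF e, of 0] by (simp add: G_def)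
    define H where "H x = sqrt (2 * pi / e) ^ n * exp (- ((norm x)\<^sup>2 / (2 * e)))" for x :: 'a
    have [measurable]: "H \<in> borel_measurable borel" unfolding H_def by measurable
    have H0: "H x \<ge> 0" for x using e by (simp add: H_def)
    have H_sym: "H (x - y) = H (y - x)" for x y by (simp add: H_def norm_minus_commute)
    have H: "(\<integral>\<xi>. complex_of_real (G \<xi>) * K x \<xi> \<partial>lborel) = complex_of_real (H x)" for x
      using fourier_gaussian(2)[OF e, of x] by (simp add: G_def H_def K_def n_def)
    have H_int: "(\<integral>\<^sup>+y. ennreal (H (x - y)) \<partial>lborel) = ennreal ((2 * pi) ^ n)" for x
    proof -
      have "(\<integral>\<^sup>+y. ennreal (H (x - y)) \<partial>lborel) = (\<integral>\<^sup>+y. ennreal (H (- x + y)) \<partial>lborel)"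
        by (subst H_sym) simp
      also have "\<dots> = (\<integral>\<^sup>+y. ennreal (H y) \<partial>distr lborel borel ((+) (- x)))"
        by (subst nn_integral_distr) auto
      also have "\<dots> = (\<integral>\<^sup>+y. ennreal (sqrt (2 * pi / e) ^ n) * ennreal (exp (- ((norm (y::'a))\<^sup>2 / (2 * e)))) \<partial>lborel)"
        using e by (simp add: lborel_distr_plus H_def ennreal_mult)
      also have "\<dots> = ennreal (sqrt (2 * pi / e) ^ n * sqrt (2 * pi * e) ^ n)"
        using e by (subst nn_integral_cmult) (auto simp: nn_integral_gaussian n_def ennreal_mult)
      also have "sqrt (2 * pi / e) ^ n * sqrt (2 * pi * e) ^ n = (2 * pi) ^ n"
      proof -
        have "sqrt (2 * pi / e) * sqrt (2 * pi * e) = sqrt ((2 * pi)\<^sup>2)"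
          using e unfolding real_sqrt_mult [symmetric] by (simp add: power2_eq_square)
        also have "\<dots> = 2 * pi" by (rule real_sqrt_unique) auto
        finally have "sqrt (2 * pi / e) * sqrt (2 * pi * e) = 2 * pi" .
        then show ?thesis by (simp only: power_mult_distrib [symmetric])
      qed
      finally show ?thesis .
    qed
    have FGint: "integrable lborel (\<lambda>\<xi>. cnj (F \<xi>) * complex_of_real (G \<xi>))"
    proof (rule Bochner_Integration.integrable_bound)
      show "integrable lborel (\<lambda>\<xi>. complex_of_real B * complex_of_real (G \<xi>))"
        using Gc by (rule integrable_mult_right)
      show "AE \<xi> in lborel. norm (cnj (F \<xi>) * complex_of_real (G \<xi>)) \<le> norm (complex_of_real B * complex_of_real (G \<xi>))"
        using F_bound by (intro AE_I2) (simp add: norm_mult mult_right_mono order_trans[OF F_bound abs_ge_self])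
    qed measurable
    \<comment> \<open>Unfolding \<open>cnj (F \<xi>)\<close> as an integral over \<open>y\<close>
      merges the two phases into \<open>K (x - y)\<close>, and integrating out \<open>\<xi>\<close>
      leaves \<open>H\<close>.\<close>
    have inner: "(\<integral>\<xi>. (cnj (F \<xi>) * complex_of_real (G \<xi>)) * K x \<xi> \<partial>lborel) =
        (\<integral>y. cnj (f y) * complex_of_real (H (x - y)) \<partial>lborel)" for x
    proof -
      have [measurable]: "K x \<in> borel_measurable borel" unfolding K_def by measurable
      have "(\<integral>\<xi>. (cnj (F \<xi>) * complex_of_real (G \<xi>)) * K x \<xi> \<partial>lborel) =
          (\<integral>\<xi>. (complex_of_real (G \<xi>) * K x \<xi>) * (\<integral>y. cnj (f y) * cnj (K y \<xi>) \<partial>lborel) \<partial>lborel)"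
      proof -
        have "cnj (F \<xi>) = (\<integral>y. cnj (f y * K y \<xi>) \<partial>lborel)" for \<xi>
          unfolding F_def by (rule Bochner_Integration.integral_cnj [symmetric])
        then show ?thesis by (simp add: ac_simps)
      qed
      also have "\<dots> = (\<integral>y. cnj (f y) * (\<integral>\<xi>. (complex_of_real (G \<xi>) * K x \<xi>) * cnj (K y \<xi>) \<partial>lborel) \<partial>lborel)"
      proof (rule bounded_kernel_Fubini)
        show "integrable lborel (\<lambda>\<xi>. complex_of_real (G \<xi>) * K x \<xi>)"
          using Gc by (rule Bochner_Integration.integrable_bound) (auto simp: norm_mult K1)
        show "integrable lborel (\<lambda>y. cnj (f y))" using f by simp
        have "(\<lambda>(y, \<xi>). cnj (K y \<xi>)) = (\<lambda>(y, \<xi>). exp (\<i> * complex_of_real (y \<bullet> \<xi>)))"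
          by (simp add: K_def exp_cnj)
        then show "(\<lambda>(y, \<xi>). cnj (K y \<xi>)) \<in> borel_measurable (borel \<Otimes>\<^sub>M borel)"
          by simp
      qed (simp add: K1)
      also have "\<dots> = (\<integral>y. cnj (f y) * (\<integral>\<xi>. complex_of_real (G \<xi>) * K (x - y) \<xi> \<partial>lborel) \<partial>lborel)"
      proof -
        have "(complex_of_real (G \<xi>) * K x \<xi>) * cnj (K y \<xi>) = complex_of_real (G \<xi>) * K (x - y) \<xi>" for y \<xi>
          by (simp add: K_def exp_cnj inner_diff_left algebra_simps flip: exp_add)
        then show ?thesis by (simp only:)
      qed
      finally show ?thesis by (simp only: H)
    qed
    have FG_eq: "(\<integral>\<xi>. F \<xi> * (cnj (F \<xi>) * complex_of_real (G \<xi>)) \<partial>lborel) =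
        (\<integral>x. f x * (\<integral>y. cnj (f y) * complex_of_real (H (x - y)) \<partial>lborel) \<partial>lborel)"
      using bounded_kernel_Fubini[OF FGint f Km, unfolded inner] K1
      by (simp add: F_def mult.commute)
    have sq: "F \<xi> * (cnj (F \<xi>) * complex_of_real (G \<xi>)) = complex_of_real ((norm (F \<xi>))\<^sup>2 * G \<xi>)" for \<xi>
      using complex_norm_square[of "F \<xi>"] by simp
    have "integrable lborel (\<lambda>\<xi>. complex_of_real B * complex_of_real B * complex_of_real (G \<xi>))"
      using Gc by (rule integrable_mult_right)
    then have "integrable lborel (\<lambda>\<xi>. (norm (F \<xi>))\<^sup>2 * G \<xi>)"
    proof (rule Bochner_Integration.integrable_bound)
      show "AE \<xi> in lborel. norm ((norm (F \<xi>))\<^sup>2 * G \<xi>) \<le> norm (complex_of_real B * complex_of_real B * complex_of_real (G \<xi>))"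
        using F_bound
        by (intro AE_I2) (auto simp: norm_mult power2_eq_square G_def
            intro!: mult_mono order_trans[OF F_bound abs_ge_self])
    qed measurable
    then have "(\<integral>\<^sup>+\<xi>. ennreal ((norm (F \<xi>))\<^sup>2 * G \<xi>) \<partial>lborel) = ennreal (\<integral>\<xi>. (norm (F \<xi>))\<^sup>2 * G \<xi> \<partial>lborel)"
      by (intro nn_integral_eq_integral) (auto simp: G_def)
    also have "\<dots> \<le> ennreal (norm (\<integral>\<xi>. F \<xi> * (cnj (F \<xi>) * complex_of_real (G \<xi>)) \<partial>lborel))"
      unfolding sq by (simp del: of_real_mult of_real_power)
    also have "\<dots> \<le> (\<integral>\<^sup>+x. ennreal (norm (f x * (\<integral>y. cnj (f y) * complex_of_real (H (x - y)) \<partial>lborel))) \<partial>lborel)"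
      unfolding FG_eq by (rule ennreal_norm_integral_le)
    also have "\<dots> \<le> (\<integral>\<^sup>+x. (\<integral>\<^sup>+y. ennreal (norm (f x) * (norm (f y) * H (x - y))) \<partial>lborel) \<partial>lborel)"
    proof (rule nn_integral_mono)
      fix x
      have "ennreal (norm (f x * (\<integral>y. cnj (f y) * complex_of_real (H (x - y)) \<partial>lborel))) \<le>
          ennreal (norm (f x)) * (\<integral>\<^sup>+y. ennreal (norm (cnj (f y) * complex_of_real (H (x - y)))) \<partial>lborel)"
        unfolding norm_mult[of "f x"] ennreal_mult'[OF norm_ge_zero]
        by (intro mult_left_mono ennreal_norm_integral_le) auto
      also have "\<dots> = (\<integral>\<^sup>+y. ennreal (norm (f x) * (norm (f y) * H (x - y))) \<partial>lborel)"
        using H0 by (subst nn_integral_cmult [symmetric]) (auto simp: norm_mult ennreal_mult)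
      finally show "ennreal (norm (f x * (\<integral>y. cnj (f y) * complex_of_real (H (x - y)) \<partial>lborel))) \<le>
          (\<integral>\<^sup>+y. ennreal (norm (f x) * (norm (f y) * H (x - y))) \<partial>lborel)" .
    qed
    \<comment> \<open>Schur test: the product |f x| |f y| is split into half the sum of squares. By
      symmetry of \<open>H\<close> both halves give the same double integral, in which the inner
      integral is the mass of \<open>H\<close>.\<close>
    also have "\<dots> \<le> (\<integral>\<^sup>+x. (\<integral>\<^sup>+y. (ennreal ((norm (f x))\<^sup>2 / 2) * ennreal (H (x - y)) +
        ennreal ((norm (f y))\<^sup>2 / 2) * ennreal (H (x - y))) \<partial>lborel) \<partial>lborel)"
    proof (intro nn_integral_mono)
      fix x y
      have "norm (f x) * norm (f y) \<le> (norm (f x))\<^sup>2 / 2 + (norm (f y))\<^sup>2 / 2"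
        using sum_squares_bound[of "norm (f x)" "norm (f y)"] by simp
      then have "norm (f x) * norm (f y) * H (x - y) \<le> ((norm (f x))\<^sup>2 / 2 + (norm (f y))\<^sup>2 / 2) * H (x - y)"
        using H0 by (rule mult_right_mono)
      then show "ennreal (norm (f x) * (norm (f y) * H (x - y))) \<le>
          ennreal ((norm (f x))\<^sup>2 / 2) * ennreal (H (x - y)) + ennreal ((norm (f y))\<^sup>2 / 2) * ennreal (H (x - y))"
        using H0 by (simp add: distrib_right mult.assoc flip: ennreal_mult ennreal_plus)
    qed
    also have "\<dots> = (\<integral>\<^sup>+x. (\<integral>\<^sup>+y. ennreal ((norm (f x))\<^sup>2 / 2) * ennreal (H (x - y)) \<partial>lborel) \<partial>lborel) +
        (\<integral>\<^sup>+x. (\<integral>\<^sup>+y. ennreal ((norm (f y))\<^sup>2 / 2) * ennreal (H (x - y)) \<partial>lborel) \<partial>lborel)"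
      by (simp add: nn_integral_add)
    also have "(\<integral>\<^sup>+x. (\<integral>\<^sup>+y. ennreal ((norm (f y))\<^sup>2 / 2) * ennreal (H (x - y)) \<partial>lborel) \<partial>lborel) =
        (\<integral>\<^sup>+y. (\<integral>\<^sup>+x. ennreal ((norm (f y))\<^sup>2 / 2) * ennreal (H (y - x)) \<partial>lborel) \<partial>lborel)"
      by (subst lborel_pair.Fubini') (auto simp: H_sym)
    also have "(\<integral>\<^sup>+x. (\<integral>\<^sup>+y. ennreal ((norm (f x))\<^sup>2 / 2) * ennreal (H (x - y)) \<partial>lborel) \<partial>lborel) =
        ennreal ((2 * pi) ^ n) * (\<integral>\<^sup>+x. ennreal ((norm (f x))\<^sup>2 / 2) \<partial>lborel)"
      by (simp add: nn_integral_cmult H_int nn_integral_multc mult.commute)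
    also have "ennreal ((2 * pi) ^ n) * (\<integral>\<^sup>+x. ennreal ((norm (f x))\<^sup>2 / 2) \<partial>lborel) +
        ennreal ((2 * pi) ^ n) * (\<integral>\<^sup>+x. ennreal ((norm (f x))\<^sup>2 / 2) \<partial>lborel) = ennreal ((2 * pi) ^ n) * N"
    proof -
      have "(\<integral>\<^sup>+x. ennreal ((norm (f x))\<^sup>2 / 2) \<partial>lborel) + (\<integral>\<^sup>+x. ennreal ((norm (f x))\<^sup>2 / 2) \<partial>lborel) = N"
      proof (subst nn_integral_add [symmetric])
        have "ennreal ((norm (f x))\<^sup>2 / 2) + ennreal ((norm (f x))\<^sup>2 / 2) = ennreal ((norm (f x))\<^sup>2)" for x
          by (subst ennreal_plus [symmetric]) (auto simp del: ennreal_plus)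
        then show "(\<integral>\<^sup>+x. ennreal ((norm (f x))\<^sup>2 / 2) + ennreal ((norm (f x))\<^sup>2 / 2) \<partial>lborel) = N"
          by (simp only: N_def)
      qed measurable
      then show ?thesis by (simp flip: distrib_left)
    qed
    finally show ?thesis by (simp add: G_def)
  qed
  \<comment> \<open>The bound \<open>main\<close> does not depend on \<open>e\<close>, so it
    persists along e = 1 / (k + 1).\<close>
  have lim: "(\<integral>\<^sup>+\<xi>. ennreal ((norm (F \<xi>))\<^sup>2) \<partial>lborel) \<le> ennreal ((2 * pi) ^ n) * N"
  proof (rule nn_integral_le_limit)
    show "AE \<xi> in lborel. (\<lambda>k. ennreal ((norm (F \<xi>))\<^sup>2 * exp (- (inverse (real (Suc k)) * (norm \<xi>)\<^sup>2 / 2))))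
        \<longlonglongrightarrow> ennreal ((norm (F \<xi>))\<^sup>2)"
    proof (intro AE_I2 tendsto_ennrealI)
      fix \<xi> :: 'a
      have "(\<lambda>k. (norm (F \<xi>))\<^sup>2 * exp (- (inverse (real (Suc k)) * (norm \<xi>)\<^sup>2 / 2))) \<longlonglongrightarrow>
          (norm (F \<xi>))\<^sup>2 * exp (- (0 * (norm \<xi>)\<^sup>2 / 2))"
        by (intro tendsto_intros LIMSEQ_inverse_real_of_nat) simp_all
      then show "(\<lambda>k. (norm (F \<xi>))\<^sup>2 * exp (- (inverse (real (Suc k)) * (norm \<xi>)\<^sup>2 / 2))) \<longlonglongrightarrow> (norm (F \<xi>))\<^sup>2"
        by simp
    qed
    show "eventually (\<lambda>k. (\<integral>\<^sup>+\<xi>. ennreal ((norm (F \<xi>))\<^sup>2 * exp (- (inverse (real (Suc k)) * (norm \<xi>)\<^sup>2 / 2))) \<partial>lborel)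
        \<le> ennreal ((2 * pi) ^ n) * N) sequentially"
      using main by (intro always_eventually allI) simp
  qed measurable
  define c where "c = (2 * pi) powr (- real n / 2)"
  have c: "c\<^sup>2 * (2 * pi) ^ n = 1"
  proof -
    have "c\<^sup>2 = (2 * pi) powr (- real n)" by (simp add: c_def power2_eq_square flip: powr_add)
    also have "\<dots> = inverse ((2 * pi) ^ n)" by (subst powr_minus, subst powr_realpow) auto
    finally show ?thesis by (simp add: field_simps)
  qed
  have "fourier_integral f \<xi> = complex_of_real c * F \<xi>" for \<xi>
    by (simp add: fourier_integral_def F_def K_def c_def n_def)
  then have "(\<integral>\<^sup>+\<xi>. ennreal ((norm (fourier_integral f \<xi>))\<^sup>2) \<partial>lborel) =
      ennreal (c\<^sup>2) * (\<integral>\<^sup>+\<xi>. ennreal ((norm (F \<xi>))\<^sup>2) \<partial>lborel)"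
    by (subst nn_integral_cmult [symmetric]) (auto simp: norm_mult power_mult_distrib simp flip: ennreal_mult)
  also have "\<dots> \<le> ennreal (c\<^sup>2) * (ennreal ((2 * pi) ^ n) * N)"
    using lim by (rule mult_left_mono) simp
  also have "\<dots> = N"
    using c by (simp add: mult.assoc [symmetric] flip: ennreal_mult)
  finally show ?thesis by (simp add: N_def)
qed

section \<open>Energies and truncations\<close>

definition truncate :: "real \<Rightarrow> ('a::euclidean_space \<Rightarrow> complex) \<Rightarrow> 'a \<Rightarrow> complex" where
  "truncate R f x = (if norm x \<le> R then f x else 0)"

text \<open>The squared L2 norm with values in \<open>ennreal\<close>, where divergence shows as
  infinity; \<open>L2_norm\<close> would silently become 0.\<close>

definition energy :: "('a::euclidean_space \<Rightarrow> complex) \<Rightarrow> ennreal" where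
  "energy f = (\<integral>\<^sup>+x. ennreal ((norm (f x))\<^sup>2) \<partial>lborel)"

lemma is_fourier_transform_truncate:
  "is_fourier_transform f F \<longleftrightarrow> square_integrable F \<and>
    ((\<lambda>R. energy (\<lambda>\<xi>. fourier_integral (truncate R f) \<xi> - F \<xi>)) \<longlongrightarrow> 0) at_top"
  by (simp add: is_fourier_transform_def energy_def truncate_def [abs_def])

lemma square_integrable_iff:
  "square_integrable f \<longleftrightarrow> f \<in> borel_measurable borel \<and> energy f < \<infinity>"
  by (auto simp: square_integrable_def energy_def integrable_iff_bounded)

lemma energy_eq_L2_norm:
  assumes "square_integrable f"
  shows "energy f = ennreal ((L2_norm f)\<^sup>2)"
proof -
  have "energy f = ennreal (\<integral>x. (norm (f x))\<^sup>2 \<partial>lborel)"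
    using assms unfolding energy_def square_integrable_def
    by (intro nn_integral_eq_integral) auto
  then show ?thesis by (simp add: L2_norm_def)
qed

lemma energy_mono_AE:
  assumes "AE x in lborel. norm (f x) \<le> norm (g x)"
  shows "energy f \<le> energy g"
  unfolding energy_def using assms by (intro nn_integral_mono_AE) (auto elim!: eventually_mono intro!: ennreal_leI power_mono)

text \<open>The elementary (a + b)^2 \<le> 2 a^2 + 2 b^2 stands in for Minkowski's inequality; the
  loss only enters the final constant.\<close>

lemma energy_diff_le:
  assumes [measurable]: "f \<in> borel_measurable borel" "g \<in> borel_measurable borel"
  shows "energy (\<lambda>x. f x - g x) \<le> 2 * energy f + 2 * energy g"
proof -
  have "energy (\<lambda>x. f x - g x) \<le>
      (\<integral>\<^sup>+x. 2 * ennreal ((norm (f x))\<^sup>2) + 2 * ennreal ((norm (g x))\<^sup>2) \<partial>lborel)"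
    unfolding energy_def
  proof (rule nn_integral_mono)
    fix x
    have "(norm (f x - g x))\<^sup>2 \<le> (norm (f x) + norm (g x))\<^sup>2"
      by (intro power_mono norm_triangle_ineq4) auto
    also have "\<dots> \<le> 2 * (norm (f x))\<^sup>2 + 2 * (norm (g x))\<^sup>2"
      using sum_squares_bound[of "norm (f x)" "norm (g x)"] by (simp add: power2_sum)
    finally have "ennreal ((norm (f x - g x))\<^sup>2) \<le> ennreal (2 * (norm (f x))\<^sup>2 + 2 * (norm (g x))\<^sup>2)"
      by (rule ennreal_leI)
    then show "ennreal ((norm (f x - g x))\<^sup>2) \<le> 2 * ennreal ((norm (f x))\<^sup>2) + 2 * ennreal ((norm (g x))\<^sup>2)"
      by (simp add: ennreal_mult)
  qed
  also have "\<dots> = 2 * energy f + 2 * energy g"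
    unfolding energy_def by (simp add: nn_integral_add nn_integral_cmult)
  finally show ?thesis .
qed

lemma square_integrable_diff:
  assumes "square_integrable f" "square_integrable g"
  shows "square_integrable (\<lambda>x. f x - g x)"
proof -
  have "energy (\<lambda>x. f x - g x) \<le> 2 * energy f + 2 * energy g"
    using assms by (intro energy_diff_le) (auto simp: square_integrable_iff)
  also have "\<dots> < \<infinity>"
    using assms by (simp add: square_integrable_iff ennreal_mult_less_top)
  finally show ?thesis using assms by (auto simp: square_integrable_iff)
qed

lemma truncate_measurable [measurable]:
  assumes [measurable]: "f \<in> borel_measurable borel"
  shows "truncate R f \<in> borel_measurable borel"
  unfolding truncate_def[abs_def] by measurable

text \<open>On the ball, |f| \<le> 1 + |f|^2, and the ball has finite measure.\<close>

lemma integrable_truncate: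
  assumes "square_integrable f"
  shows "integrable lborel (truncate R f)"
proof -
  have [measurable]: "f \<in> borel_measurable borel" using assms by (simp add: square_integrable_iff)
  have int: "integrable lborel (\<lambda>x. indicator (cball 0 R) x + (norm (f x))\<^sup>2)"
    using assms
    by (intro Bochner_Integration.integrable_add integrable_real_indicator)
       (auto simp: square_integrable_def simp: emeasure_bounded_finite[OF bounded_cball, simplified])
  show ?thesis
  proof (rule Bochner_Integration.integrable_bound[OF int])
    show "AE x in lborel. norm (truncate R f x) \<le> norm (indicator (cball 0 R) x + (norm (f x))\<^sup>2)"
    proof (rule AE_I2)
      fix x
      have "norm (f x) \<le> 1 + (norm (f x))\<^sup>2"
        using sum_squares_bound[of 1 "norm (f x)"] norm_ge_zero[of "f x"]
        unfolding one_power2 mult_1_right by linarith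
      then show "norm (truncate R f x) \<le> norm (indicator (cball 0 R) x + (norm (f x))\<^sup>2 :: real)"
        by (auto simp: truncate_def indicator_def)
    qed
  qed measurable
qed

lemma fourier_integral_measurable [measurable]:
  assumes [measurable]: "f \<in> borel_measurable borel"
  shows "fourier_integral f \<in> borel_measurable borel"
  unfolding fourier_integral_def[abs_def] by measurable

lemma fourier_integral_diff:
  assumes "integrable lborel f" "integrable lborel g"
  shows "fourier_integral (\<lambda>x. f x - g x) \<xi> = fourier_integral f \<xi> - fourier_integral g \<xi>"
proof -
  have "integrable lborel (\<lambda>x. h x * exp (- (\<i> * complex_of_real (x \<bullet> \<xi>))))"
    if h: "integrable lborel h" for h
    by (rule Bochner_Integration.integrable_bound[OF h])
       (use h in \<open>auto simp: norm_mult\<close>)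
  from this[OF assms(1)] this[OF assms(2)] show ?thesis
    by (simp add: fourier_integral_def left_diff_distrib right_diff_distrib)
qed

lemma fourier_integral_cong_AE:
  assumes "f \<in> borel_measurable borel" "g \<in> borel_measurable borel" "AE x in lborel. f x = g x"
  shows "fourier_integral f \<xi> = fourier_integral g \<xi>"
  unfolding fourier_integral_def using assms
  by (intro arg_cong2[where f = "(*)"] refl integral_cong_AE) auto

definition tail_energy :: "('a::euclidean_space \<Rightarrow> complex) \<Rightarrow> real \<Rightarrow> ennreal" where
  "tail_energy f R = energy (\<lambda>x. if norm x \<le> R then 0 else f x)"

lemma tail_energy_antimono: "R \<le> S \<Longrightarrow> tail_energy f S \<le> tail_energy f R"
  unfolding tail_energy_def by (intro energy_mono_AE AE_I2) auto

lemma tendsto_tail_energy: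
  fixes f :: "'a::euclidean_space \<Rightarrow> complex"
  assumes f: "square_integrable f"
  shows "(tail_energy f \<longlongrightarrow> 0) at_top"
proof -
  have [measurable]: "f \<in> borel_measurable borel" using f by (simp add: square_integrable_iff)
  have "(\<lambda>n. \<integral>\<^sup>+x. ennreal ((norm (if norm x \<le> real n then 0 else f x))\<^sup>2) \<partial>lborel) \<longlonglongrightarrow>
      (\<integral>\<^sup>+x. 0 \<partial>(lborel :: 'a measure))"
  proof (rule nn_integral_dominated_convergence[where w = "\<lambda>x. ennreal ((norm (f x))\<^sup>2)"])
    show "(\<integral>\<^sup>+x. ennreal ((norm (f x))\<^sup>2) \<partial>lborel) < \<infinity>"
      using f by (simp add: square_integrable_iff energy_def)
    show "AE x in lborel. (\<lambda>n. ennreal ((norm (if norm x \<le> real n then 0 else f x))\<^sup>2)) \<longlonglongrightarrow> 0"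
    proof (rule AE_I2, rule tendsto_eventually)
      fix x :: 'a
      show "eventually (\<lambda>n. ennreal ((norm (if norm x \<le> real n then 0 else f x))\<^sup>2) = 0) sequentially"
        using eventually_ge_at_top[of "nat \<lceil>norm x\<rceil>"]
        by eventually_elim (auto simp: nat_le_iff ceiling_le_iff)
    qed
  qed auto
  then have lim: "(\<lambda>n. tail_energy f (real n)) \<longlonglongrightarrow> 0"
    by (simp add: tail_energy_def energy_def)
  \<comment> \<open>Monotonicity in the radius extends the limit along the integers to real
    radii.\<close>
  show ?thesis
  proof (rule order_tendstoI)
    fix a :: ennreal assume "0 < a"
    from order_tendstoD(2)[OF lim this] obtain n where n: "tail_energy f (real n) < a"
      unfolding eventually_sequentially by blast
    show "eventually (\<lambda>R. tail_energy f R < a) at_top"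
      using eventually_ge_at_top[of "real n"]
      by eventually_elim (use n tail_energy_antimono in \<open>blast intro: le_less_trans\<close>)
  qed simp
qed

section \<open>Existence of the L2 transform\<close>

text \<open>The Cauchy property of the truncated transforms: the difference of the truncations lives
  outside the ball of radius \<open>R\<close>, and its transform has no more energy.\<close>

lemma energy_fourier_integral_truncate_diff:
  assumes f: "square_integrable f" and "R \<le> S"
  shows "energy (\<lambda>\<xi>. fourier_integral (truncate S f) \<xi> - fourier_integral (truncate R f) \<xi>) \<le> tail_energy f R"
proof -
  have "energy (\<lambda>\<xi>. fourier_integral (truncate S f) \<xi> - fourier_integral (truncate R f) \<xi>) =
      energy (fourier_integral (\<lambda>x. truncate S f x - truncate R f x))"
    using fourier_integral_diff[OF integrable_truncate[OF f] integrable_truncate[OF f], of S R]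
    by (simp add: energy_def)
  also have "\<dots> \<le> energy (\<lambda>x. truncate S f x - truncate R f x)"
    unfolding energy_def using integrable_truncate[OF f]
    by (intro fourier_integral_bessel) simp
  also have "\<dots> \<le> tail_energy f R"
    unfolding tail_energy_def using assms by (intro energy_mono_AE AE_I2) (auto simp: truncate_def)
  finally show ?thesis .
qed

text \<open>By 2 d \<le> 2^(-k) + 2^k d^2 the increments are absolutely summable. Squares are used
  because they integrate to energies, so pointwise convergence can be read off energy
  bounds.\<close>

lemma convergent_of_summable_weighted_squares:
  fixes h :: "nat \<Rightarrow> complex"
  assumes "summable (\<lambda>k. 2 ^ k * (norm (h (Suc k) - h k))\<^sup>2)"
  shows "convergent h"
proof -
  have "summable (\<lambda>k. ((1 / 2) ^ k + 2 ^ k * (norm (h (Suc k) - h k))\<^sup>2) / 2)"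
    using assms by (intro summable_divide summable_add summable_geometric) auto
  then have "summable (\<lambda>k. h (Suc k) - h k)"
  proof (rule summable_comparison_test')
    fix k :: nat
    define d where "d = norm (h (Suc k) - h k)"
    have "2 * (2 ^ k * d) \<le> 1 + (2 ^ k * d)\<^sup>2"
      using sum_squares_bound[of 1 "2 ^ k * d"] by simp
    also have "\<dots> = 2 ^ k * ((1 / 2) ^ k + 2 ^ k * d\<^sup>2)"
      by (simp add: power2_eq_square algebra_simps power_divide)
    finally have "2 ^ k * (2 * d) \<le> 2 ^ k * ((1 / 2) ^ k + 2 ^ k * d\<^sup>2)" by simp
    then have "2 * d \<le> (1 / 2) ^ k + 2 ^ k * d\<^sup>2"
      by (subst (asm) mult_le_cancel_left_pos) auto
    then show "norm (h (Suc k) - h k) \<le> ((1 / 2) ^ k + 2 ^ k * (norm (h (Suc k) - h k))\<^sup>2) / 2"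
      by (simp add: d_def)
  qed
  then have "(\<lambda>n. (\<Sum>k<n. h (Suc k) - h k) + h 0) \<longlonglongrightarrow> (\<Sum>k. h (Suc k) - h k) + h 0"
    by (intro tendsto_add summable_LIMSEQ tendsto_const)
  then show ?thesis
    by (auto simp: sum_lessThan_telescope convergent_def)
qed

text \<open>Riesz-Fischer: along radii with tail energy below 4^(-k), the energies of the increments
  weighted by 2^k have a finite sum, so the transforms converge almost everywhere. Fatou's lemma
  then gives both the L2 limit over all radii and the norm inequality.\<close>

lemma fourier_transform_exists:
  fixes f :: "'a::euclidean_space \<Rightarrow> complex"
  assumes f: "square_integrable f"
  shows "\<exists>F. is_fourier_transform f F \<and> energy F \<le> energy f"
proof -
  have [measurable]: "f \<in> borel_measurable borel" using f by (simp add: square_integrable_iff)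
  have "\<exists>N. \<forall>R\<ge>N. tail_energy f R < ennreal ((1 / 4) ^ k)" for k :: nat
    using order_tendstoD(2)[OF tendsto_tail_energy[OF f], of "ennreal ((1 / 4) ^ k)"]
    unfolding eventually_at_top_linorder by simp
  then obtain N where N: "\<And>k R. R \<ge> N k \<Longrightarrow> tail_energy f R < ennreal ((1 / 4) ^ k)"
    by metis
  \<comment> \<open>Partial sums make the radii increasing while keeping them above
    \<open>N k\<close>; the summand 1 drives them to infinity.\<close>
  define m where "m k = (\<Sum>j\<le>k. \<bar>N j\<bar> + 1)" for k
  have m_N: "m k \<ge> N k" for k
  proof -
    have "\<bar>N k\<bar> + 1 \<le> m k" unfolding m_def by (intro member_le_sum) auto
    then show ?thesis by linarith
  qed
  have m_Suc: "m k \<le> m (Suc k)" for k by (simp add: m_def)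
  have m_ge: "m k \<ge> real k" for k by (induction k) (auto simp: m_def)
  define h where "h k = fourier_integral (truncate (m k) f)" for k
  have [measurable]: "h k \<in> borel_measurable borel" for k unfolding h_def by measurable
  define F where "F \<xi> = lim (\<lambda>k. h k \<xi>)" for \<xi>
  have [measurable]: "F \<in> borel_measurable borel" unfolding F_def by measurable
  have "(\<integral>\<^sup>+\<xi>. (\<Sum>k. ennreal (2 ^ k * (norm (h (Suc k) \<xi> - h k \<xi>))\<^sup>2)) \<partial>lborel) =
      (\<Sum>k. \<integral>\<^sup>+\<xi>. ennreal (2 ^ k * (norm (h (Suc k) \<xi> - h k \<xi>))\<^sup>2) \<partial>lborel)"
    by (rule nn_integral_suminf) measurable
  also have "\<dots> \<le> (\<Sum>k. ennreal ((1 / 2) ^ k))"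
  proof (intro suminf_le allI summableI)
    fix k
    have "(\<integral>\<^sup>+\<xi>. ennreal (2 ^ k * (norm (h (Suc k) \<xi> - h k \<xi>))\<^sup>2) \<partial>lborel) =
        ennreal (2 ^ k) * energy (\<lambda>\<xi>. h (Suc k) \<xi> - h k \<xi>)"
      unfolding energy_def by (simp add: ennreal_mult nn_integral_cmult)
    also have "\<dots> \<le> ennreal (2 ^ k) * ennreal ((1 / 4) ^ k)"
      using energy_fourier_integral_truncate_diff[OF f m_Suc[of k]] N[OF m_N[of k]]
      unfolding h_def by (intro mult_left_mono) auto
    also have "\<dots> = ennreal ((1 / 2) ^ k)"
      by (simp flip: ennreal_mult power_mult_distrib)
    finally show "(\<integral>\<^sup>+\<xi>. ennreal (2 ^ k * (norm (h (Suc k) \<xi> - h k \<xi>))\<^sup>2) \<partial>lborel) \<le> ennreal ((1 / 2) ^ k)" .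
  qed
  also have "\<dots> = ennreal (\<Sum>k. (1 / 2) ^ k)"
    by (intro suminf_ennreal2 summable_geometric) auto
  also have "\<dots> < \<infinity>" by simp
  finally have "AE \<xi> in lborel. (\<Sum>k. ennreal (2 ^ k * (norm (h (Suc k) \<xi> - h k \<xi>))\<^sup>2)) \<noteq> \<infinity>"
    by (intro nn_integral_noteq_infinite) auto
  then have conv: "AE \<xi> in lborel. (\<lambda>k. h k \<xi>) \<longlonglongrightarrow> F \<xi>"
  proof eventually_elim
    case (elim \<xi>)
    then have "summable (\<lambda>k. 2 ^ k * (norm (h (Suc k) \<xi> - h k \<xi>))\<^sup>2)"
      by (intro summable_suminf_not_top) auto
    then show ?case
      unfolding F_def by (rule convergent_of_summable_weighted_squares[THEN convergent_LIMSEQ_iff[THEN iffD1]])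
  qed
  \<comment> \<open>For fixed \<open>R\<close>, eventually \<open>R \<le> m k\<close>, and the
    Cauchy estimate passes to the limit in \<open>k\<close>.\<close>
  have tail: "energy (\<lambda>\<xi>. fourier_integral (truncate R f) \<xi> - F \<xi>) \<le> tail_energy f R" for R
    unfolding energy_def
  proof (rule nn_integral_le_limit)
    show "AE \<xi> in lborel. (\<lambda>k. ennreal ((norm (fourier_integral (truncate R f) \<xi> - h k \<xi>))\<^sup>2)) \<longlonglongrightarrow>
        ennreal ((norm (fourier_integral (truncate R f) \<xi> - F \<xi>))\<^sup>2)"
      using conv by eventually_elim (intro tendsto_intros tendsto_ennrealI)
    show "eventually (\<lambda>k. (\<integral>\<^sup>+\<xi>. ennreal ((norm (fourier_integral (truncate R f) \<xi> - h k \<xi>))\<^sup>2) \<partial>lborel) \<le> tail_energy f R) sequentially"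
      using eventually_ge_at_top[of "nat \<lceil>R\<rceil>"]
    proof eventually_elim
      case (elim k)
      then have "R \<le> m k" using m_ge[of k] by (simp add: nat_le_iff ceiling_le_iff)
      from energy_fourier_integral_truncate_diff[OF f this] show ?case
        by (simp add: energy_def h_def norm_minus_commute)
    qed
  qed measurable
  have le: "energy F \<le> energy f"
    unfolding energy_def
  proof (rule nn_integral_le_limit)
    show "AE \<xi> in lborel. (\<lambda>k. ennreal ((norm (h k \<xi>))\<^sup>2)) \<longlonglongrightarrow> ennreal ((norm (F \<xi>))\<^sup>2)"
      using conv by eventually_elim (intro tendsto_intros tendsto_ennrealI)
    show "eventually (\<lambda>k. (\<integral>\<^sup>+\<xi>. ennreal ((norm (h k \<xi>))\<^sup>2) \<partial>lborel) \<le> (\<integral>\<^sup>+x. ennreal ((norm (f x))\<^sup>2) \<partial>lborel)) sequentially"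
    proof (intro always_eventually allI)
      fix k
      have "(\<integral>\<^sup>+\<xi>. ennreal ((norm (h k \<xi>))\<^sup>2) \<partial>lborel) \<le> energy (truncate (m k) f)"
        unfolding h_def energy_def by (intro fourier_integral_bessel integrable_truncate f)
      also have "\<dots> \<le> energy f"
        by (intro energy_mono_AE AE_I2) (auto simp: truncate_def)
      finally show "(\<integral>\<^sup>+\<xi>. ennreal ((norm (h k \<xi>))\<^sup>2) \<partial>lborel) \<le> (\<integral>\<^sup>+x. ennreal ((norm (f x))\<^sup>2) \<partial>lborel)"
        by (simp add: energy_def)
    qed
  qed measurable
  have "square_integrable F"
    using le f by (auto simp: square_integrable_iff intro: le_less_trans)
  moreover have "((\<lambda>R. energy (\<lambda>\<xi>. fourier_integral (truncate R f) \<xi> - F \<xi>)) \<longlongrightarrow> 0) at_top"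
    by (rule tendsto_sandwich[OF _ _ tendsto_const tendsto_tail_energy[OF f]])
       (simp_all add: tail)
  ultimately show ?thesis using le by (auto simp: is_fourier_transform_truncate)
qed

section \<open>Linearity and uniqueness of the transform\<close>

text \<open>\<open>k\<close> is a separate function, equal to the difference only almost everywhere,
  because the final value \<open>u T = g\<close> is itself given only up to a null set.\<close>

lemma fourier_transform_diff:
  assumes f: "square_integrable f" and g: "square_integrable g" and k: "square_integrable k"
    and eq: "AE x in lborel. k x = f x - g x"
    and F: "is_fourier_transform f F" and G: "is_fourier_transform g G"
  shows "is_fourier_transform k (\<lambda>\<xi>. F \<xi> - G \<xi>)"
  unfolding is_fourier_transform_truncate
proof
  have sq: "square_integrable F" "square_integrable G"
    using F G by (auto simp: is_fourier_transform_truncate)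
  then show "square_integrable (\<lambda>\<xi>. F \<xi> - G \<xi>)" by (rule square_integrable_diff)
  have [measurable]: "f \<in> borel_measurable borel" "g \<in> borel_measurable borel" "k \<in> borel_measurable borel"
    "F \<in> borel_measurable borel" "G \<in> borel_measurable borel"
    using f g k sq by (auto simp: square_integrable_iff)
  have tr: "fourier_integral (truncate R k) \<xi> = fourier_integral (truncate R f) \<xi> - fourier_integral (truncate R g) \<xi>"
    for R \<xi>
    unfolding fourier_integral_diff[OF integrable_truncate[OF f] integrable_truncate[OF g], symmetric]
    using eq by (intro fourier_integral_cong_AE) (auto simp: truncate_def elim!: eventually_mono)
  have bound: "energy (\<lambda>\<xi>. fourier_integral (truncate R k) \<xi> - (F \<xi> - G \<xi>)) \<le>
      2 * energy (\<lambda>\<xi>. fourier_integral (truncate R f) \<xi> - F \<xi>) +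
      2 * energy (\<lambda>\<xi>. fourier_integral (truncate R g) \<xi> - G \<xi>)" for R
  proof -
    have "energy (\<lambda>\<xi>. fourier_integral (truncate R k) \<xi> - (F \<xi> - G \<xi>)) =
        energy (\<lambda>\<xi>. (fourier_integral (truncate R f) \<xi> - F \<xi>) - (fourier_integral (truncate R g) \<xi> - G \<xi>))"
      unfolding tr by (simp add: algebra_simps)
    then show ?thesis by (simp add: energy_diff_le)
  qed
  have "((\<lambda>R. 2 * energy (\<lambda>\<xi>. fourier_integral (truncate R f) \<xi> - F \<xi>) +
      2 * energy (\<lambda>\<xi>. fourier_integral (truncate R g) \<xi> - G \<xi>)) \<longlongrightarrow> 2 * 0 + 2 * 0) at_top"
    using F G unfolding is_fourier_transform_truncate
    by (intro tendsto_add ennreal_tendsto_cmult) auto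
  then have lim: "((\<lambda>R. 2 * energy (\<lambda>\<xi>. fourier_integral (truncate R f) \<xi> - F \<xi>) +
      2 * energy (\<lambda>\<xi>. fourier_integral (truncate R g) \<xi> - G \<xi>)) \<longlongrightarrow> 0) at_top"
    by simp
  show "((\<lambda>R. energy (\<lambda>\<xi>. fourier_integral (truncate R k) \<xi> - (F \<xi> - G \<xi>))) \<longlongrightarrow> 0) at_top"
    by (rule tendsto_sandwich[OF _ _ tendsto_const lim]) (simp_all add: bound)
qed

lemma fourier_transform_zero:
  fixes F :: "'a::euclidean_space \<Rightarrow> complex"
  assumes "is_fourier_transform (\<lambda>x. 0) F"
  shows "AE \<xi> in lborel. F \<xi> = 0"
proof -
  have "energy F = energy (\<lambda>\<xi>. - F \<xi>)" by (simp add: energy_def)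
  moreover have "((\<lambda>R::real. energy (\<lambda>\<xi>. - F \<xi>)) \<longlongrightarrow> 0) at_top"
    using assms unfolding is_fourier_transform_truncate
    by (simp add: truncate_def fourier_integral_def)
  ultimately have "energy F = 0" by (simp add: tendsto_const_iff)
  moreover have "F \<in> borel_measurable borel"
    using assms by (simp add: is_fourier_transform_truncate square_integrable_iff)
  ultimately have "AE \<xi> in lborel. ennreal ((norm (F \<xi>))\<^sup>2) = 0"
    unfolding energy_def by (subst (asm) nn_integral_0_iff_AE) auto
  then show ?thesis by eventually_elim simp
qed

lemma is_fourier_transform_fourier:
  "square_integrable f \<Longrightarrow> is_fourier_transform f (fourier f)"
  unfolding fourier_def using fourier_transform_exists[of f]
  by (intro someI_ex[of "is_fourier_transform f"]) blast

text \<open>Uniqueness by linearity: the difference of two transforms of \<open>f\<close> is a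
  transform of 0.\<close>

lemma fourier_eqI:
  assumes f: "square_integrable f" and F: "is_fourier_transform f F"
  shows "AE \<xi> in lborel. fourier f \<xi> = F \<xi>"
proof -
  have "is_fourier_transform (\<lambda>x. 0) (\<lambda>\<xi>. fourier f \<xi> - F \<xi>)"
    using f by (intro fourier_transform_diff[OF f f _ _ is_fourier_transform_fourier[OF f] F])
      (auto simp: square_integrable_def)
  from fourier_transform_zero[OF this] show ?thesis by eventually_elim simp
qed

lemma square_integrable_fourier:
  "square_integrable f \<Longrightarrow> square_integrable (fourier f)"
  using is_fourier_transform_fourier[of f] by (simp add: is_fourier_transform_def)

text \<open>Existence provides the bound for one transform; uniqueness carries it over to the chosen
  one.\<close>

lemma energy_fourier_le:
  assumes f: "square_integrable f"
  shows "energy (fourier f) \<le> energy f"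
proof -
  obtain F where F: "is_fourier_transform f F" "energy F \<le> energy f"
    using fourier_transform_exists[OF f] by blast
  have "energy (fourier f) \<le> energy F"
    using fourier_eqI[OF f F(1)] by (intro energy_mono_AE) (auto elim!: eventually_mono)
  with F(2) show ?thesis by simp
qed

lemma fourier_diff:
  assumes "square_integrable f" "square_integrable g" "square_integrable k"
    and "AE x in lborel. k x = f x - g x"
  shows "AE \<xi> in lborel. fourier k \<xi> = fourier f \<xi> - fourier g \<xi>"
  using assms(1,2)
  by (intro fourier_eqI[OF assms(3)] fourier_transform_diff[OF assms] is_fourier_transform_fourier)

section \<open>The regularization error\<close>

lemma mittag_leffler_two_sided_bounds:
  fixes \<gamma> T :: real
  assumes \<gamma>: "0 < \<gamma>" "\<gamma> < 1" and T: "0 < T"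
  obtains D1 D2 where "0 < D1" "0 < D2"
    "\<And>t r. 0 < mittag_leffler \<gamma> 1 (- (r\<^sup>2 * t powr \<gamma>))"
    "\<And>t r. 0 < t \<Longrightarrow> t \<le> T \<Longrightarrow> mittag_leffler \<gamma> 1 (- (r\<^sup>2 * t powr \<gamma>)) * (1 + r\<^sup>2) \<le> D1 / t powr \<gamma>"
    "\<And>r. 1 \<le> D2 * (1 + r\<^sup>2) * mittag_leffler \<gamma> 1 (- (r\<^sup>2 * T powr \<gamma>))"
proof -
  define a where "a = Gamma (1 - \<gamma>)"
  define b where "b = Gamma (1 + \<gamma>)"
  have a: "a > 0" unfolding a_def using \<gamma> by (intro Gamma_real_pos) auto
  have b: "b > 0" unfolding b_def using \<gamma> by (intro Gamma_real_pos) auto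
  show ?thesis
  \<comment> \<open>For \<open>D1\<close>, with x = t^\<gamma>, split (1 + r^2) x: the term x is at
    most T^\<gamma>, and r^2 x is b times the second term of the denominator 1 + r^2 x / b.
    \<open>D2\<close> comes from 1 + a r^2 T^\<gamma> \<le> (1 + a T^\<gamma>) (1 + r^2).\<close>
  proof (rule that[of "T powr \<gamma> + b" "1 + a * T powr \<gamma>"])
    show "0 < T powr \<gamma> + b" "0 < 1 + a * T powr \<gamma>" using a b by (auto intro: add_nonneg_pos add_pos_nonneg)
    fix r :: real
    have low: "1 / (1 + a * (r\<^sup>2 * t powr \<gamma>)) \<le> mittag_leffler \<gamma> 1 (- (r\<^sup>2 * t powr \<gamma>))" for t
      unfolding a_def by (rule mittag_leffler_lower_bound[OF \<gamma>]) simp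
    have den: "0 < 1 + a * (r\<^sup>2 * t powr \<gamma>)" for t
      using a by (intro add_pos_nonneg) auto
    show "0 < mittag_leffler \<gamma> 1 (- (r\<^sup>2 * t powr \<gamma>))" for t
      using low[of t] den[of t] by (meson less_le_trans zero_less_divide_1_iff)
    have "1 + a * (r\<^sup>2 * T powr \<gamma>) \<le> (1 + a * T powr \<gamma>) * (1 + r\<^sup>2)"
      using a by (simp add: algebra_simps)
    then have "1 \<le> (1 + a * T powr \<gamma>) * (1 + r\<^sup>2) * (1 / (1 + a * (r\<^sup>2 * T powr \<gamma>)))"
      using den[of T] by simp
    also have "\<dots> \<le> (1 + a * T powr \<gamma>) * (1 + r\<^sup>2) * mittag_leffler \<gamma> 1 (- (r\<^sup>2 * T powr \<gamma>))"
      using low a by (intro mult_left_mono) auto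
    finally show "1 \<le> (1 + a * T powr \<gamma>) * (1 + r\<^sup>2) * mittag_leffler \<gamma> 1 (- (r\<^sup>2 * T powr \<gamma>))" .
    fix t :: real assume t: "0 < t" "t \<le> T"
    define x where "x = t powr \<gamma>"
    have x: "0 < x" "x \<le> T powr \<gamma>" using t \<gamma> by (auto simp: x_def intro: powr_mono2)
    have up: "mittag_leffler \<gamma> 1 (- (r\<^sup>2 * x)) \<le> 1 / (1 + r\<^sup>2 * x / b)"
      unfolding b_def using x by (intro mittag_leffler_upper_bound[OF \<gamma>]) auto
    have den': "0 < 1 + r\<^sup>2 * x / b" using x b by (intro add_pos_nonneg) auto
    have "(1 + r\<^sup>2) * x \<le> (T powr \<gamma> + b) * (1 + r\<^sup>2 * x / b)"
    proof -
      have "x \<le> T powr \<gamma>" by fact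
      moreover have "0 \<le> T powr \<gamma> * (r\<^sup>2 * x / b)" using x b by simp
      moreover have "b * (r\<^sup>2 * x / b) = r\<^sup>2 * x" using b by simp
      ultimately show ?thesis using b by (simp only: distrib_left distrib_right mult_1 mult_1_right)
    qed
    then have "1 / (1 + r\<^sup>2 * x / b) * (1 + r\<^sup>2) \<le> (T powr \<gamma> + b) / x"
      using den' x by (simp add: pos_divide_le_eq pos_le_divide_eq)
    moreover have "mittag_leffler \<gamma> 1 (- (r\<^sup>2 * x)) * (1 + r\<^sup>2) \<le> 1 / (1 + r\<^sup>2 * x / b) * (1 + r\<^sup>2)"
      using up by (intro mult_right_mono) auto
    ultimately show "mittag_leffler \<gamma> 1 (- (r\<^sup>2 * t powr \<gamma>)) * (1 + r\<^sup>2) \<le> (T powr \<gamma> + b) / t powr \<gamma>"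
      by (simp add: x_def)
  qed
qed

text \<open>A continuous function on the half-line that tends to 0 is bounded. Having
  \<open>1 \<le> K\<close> lets the same constant bound the bare filter when l = 0.\<close>

lemma bounded_powr_exp:
  fixes c a \<tau> s :: real
  assumes "0 < c" "0 < \<tau>" "0 < s"
  obtains K where "1 \<le> K" "\<And>y. 0 \<le> y \<Longrightarrow> (c + y\<^sup>2) powr a * exp (- \<tau> * y powr s) \<le> K"
proof -
  define f where "f y = (c + y\<^sup>2) powr a * exp (- \<tau> * y powr s)" for y
  have "(f \<longlongrightarrow> 0) at_top" unfolding f_def using assms by real_asymp
  then have "eventually (\<lambda>y. f y < 1) at_top" by (rule order_tendstoD) simp
  then obtain Y where Y: "\<And>y. y \<ge> Y \<Longrightarrow> f y < 1" unfolding eventually_at_top_linorder by blast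
  have pos: "0 < c + y\<^sup>2" for y using assms by (intro add_pos_nonneg) auto
  have "continuous_on {0..\<bar>Y\<bar>} f"
    unfolding f_def using assms
    by (intro continuous_on_mult continuous_on_powr' continuous_on_exp continuous_intros)
       (use pos in \<open>auto simp: less_le\<close>)
  then have "compact (f ` {0..\<bar>Y\<bar>})" by (intro compact_continuous_image) auto
  then have "bounded (f ` {0..\<bar>Y\<bar>})" by (rule compact_imp_bounded)
  then obtain B where B: "\<And>y. y \<in> {0..\<bar>Y\<bar>} \<Longrightarrow> norm (f y) \<le> B" unfolding bounded_iff by blast
  show ?thesis
  proof (rule that[of "max 1 B"])
    fix y :: real assume "0 \<le> y"
    then have "f y \<le> max 1 B"
      using B[of y] Y[of y] by (cases "y \<le> \<bar>Y\<bar>") (auto simp: le_max_iff_disj intro: less_imp_le)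
    then show "(c + y\<^sup>2) powr a * exp (- \<tau> * y powr s) \<le> max 1 B" by (simp add: f_def)
  qed simp
qed

text \<open>The qualification of the filter, and the source of the condition p + 2 - l \<le> s. With
  y = \<alpha> r, the factor 1 - exp(-\<tau> y^s) is at most \<tau> y^s \<le> \<tau> y^m for y \<le>
  1 and at most 1 \<le> y^m for y > 1; the weight then cancels r^m.\<close>

lemma one_minus_exp_filter_bound:
  fixes \<tau> s m \<alpha> r :: real
  assumes "0 < \<tau>" "0 < s" "0 \<le> m" "m \<le> s" "0 < \<alpha>" "0 \<le> r"
  shows "(1 + r\<^sup>2) powr (- m / 2) * (1 - exp (- \<tau> * (\<alpha> * r) powr s)) \<le> (1 + \<tau>) * \<alpha> powr m"
proof (cases "r = 0")
  case False
  then have r: "0 < r" using assms by simp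
  define y where "y = \<alpha> * r"
  have y: "0 < y" using r assms by (simp add: y_def)
  have "1 - exp (- \<tau> * y powr s) \<le> (1 + \<tau>) * y powr m"
  proof (cases "y \<le> 1")
    case True
    have "1 - exp (- \<tau> * y powr s) \<le> \<tau> * y powr s"
      using exp_ge_add_one_self[of "- \<tau> * y powr s"] by simp
    also have "\<dots> \<le> \<tau> * y powr m"
      using True y assms by (intro mult_left_mono powr_mono') auto
    also have "\<dots> \<le> (1 + \<tau>) * y powr m" by (intro mult_right_mono) auto
    finally show ?thesis .
  next
    case False
    have "1 - exp (- \<tau> * y powr s) \<le> 1 * 1" by simp
    also have "\<dots> \<le> (1 + \<tau>) * y powr m"
      using False assms ge_one_powr_ge_zero[of y m] by (intro mult_mono) auto
    finally show ?thesis .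
  qed
  moreover have "(1 + r\<^sup>2) powr (- m / 2) \<le> r powr (- m)"
  proof -
    have "(1 + r\<^sup>2) powr (- m / 2) \<le> (r\<^sup>2) powr (- m / 2)"
      using assms r by (intro powr_mono2') auto
    also have "\<dots> = r powr (- m)"
      using r powr_powr[of r 2 "- m / 2"] by (simp add: powr_numeral)
    finally show ?thesis .
  qed
  ultimately have "(1 + r\<^sup>2) powr (- m / 2) * (1 - exp (- \<tau> * y powr s)) \<le>
      r powr (- m) * ((1 + \<tau>) * y powr m)"
    using assms by (intro mult_mono) auto
  also have "\<dots> = (1 + \<tau>) * \<alpha> powr m"
    using r assms by (simp add: y_def powr_mult powr_minus)
  finally show ?thesis by (simp add: y_def)
qed (use assms in simp)

text \<open>Rescaling by y = \<alpha> r turns (1 + r^2) \<alpha>^2 into \<alpha>^2 + y^2. Enlarging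
  this to 1 + A^2 + y^2 makes the base at least 1, so the exponent can be raised to P / 2 and
  \<open>K\<close> depends neither on l nor on \<alpha>. At \<open>r = 0\<close> the claim reads
  \<alpha>^l \<le> K, hence the bound \<open>A\<close> on \<alpha>.\<close>

lemma exp_filter_bound:
  fixes \<tau> s l P \<alpha> A K r :: real
  assumes K: "\<And>y. 0 \<le> y \<Longrightarrow> (1 + A\<^sup>2 + y\<^sup>2) powr (P / 2) * exp (- \<tau> * y powr s) \<le> K"
    and "0 \<le> l" "l \<le> P" "0 < \<alpha>" "\<alpha> \<le> A" "0 \<le> r"
  shows "(1 + r\<^sup>2) powr (l / 2) * exp (- \<tau> * (\<alpha> * r) powr s) \<le> K * \<alpha> powr (- l)"
proof -
  define y where "y = \<alpha> * r"
  have "(1 + r\<^sup>2) powr (l / 2) * \<alpha> powr l = (\<alpha>\<^sup>2 + y\<^sup>2) powr (l / 2)"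
  proof -
    have "\<alpha> powr l = (\<alpha>\<^sup>2) powr (l / 2)"
      using assms powr_powr[of \<alpha> 2 "l / 2"] by (simp add: powr_numeral)
    moreover have "(1 + r\<^sup>2) * \<alpha>\<^sup>2 = \<alpha>\<^sup>2 + y\<^sup>2"
      by (simp add: y_def algebra_simps power_mult_distrib)
    ultimately show ?thesis by (simp flip: powr_mult)
  qed
  also have "\<dots> \<le> (1 + A\<^sup>2 + y\<^sup>2) powr (l / 2)"
  proof (intro powr_mono2)
    have "\<alpha>\<^sup>2 \<le> A\<^sup>2" using assms by (intro power_mono) auto
    then show "\<alpha>\<^sup>2 + y\<^sup>2 \<le> 1 + A\<^sup>2 + y\<^sup>2" by simp
  qed (use assms in auto)
  also have "\<dots> \<le> (1 + A\<^sup>2 + y\<^sup>2) powr (P / 2)"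
    using assms by (intro powr_mono) auto
  finally have "((1 + r\<^sup>2) powr (l / 2) * \<alpha> powr l) * exp (- \<tau> * y powr s) \<le>
      (1 + A\<^sup>2 + y\<^sup>2) powr (P / 2) * exp (- \<tau> * y powr s)"
    by (rule mult_right_mono) simp
  also have "\<dots> \<le> K" using assms by (intro K) (simp add: y_def)
  finally have "(1 + r\<^sup>2) powr (l / 2) * exp (- \<tau> * y powr s) * \<alpha> powr l * \<alpha> powr (- l) \<le> K * \<alpha> powr (- l)"
    by (intro mult_right_mono) (auto simp: ac_simps)
  then show ?thesis
    using assms by (simp add: y_def powr_minus mult.assoc)
qed

text \<open>The numerator of x / y - 1 is at most 2 h and the denominator at least 1/2, hence 4 h;
  then 3 = 1 + 4 (1/2).\<close>

lemma relative_error_quotient: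
  fixes x y h :: real
  assumes "\<bar>x - 1\<bar> \<le> h" "\<bar>y - 1\<bar> \<le> h" "h \<le> 1 / 2"
  shows "0 < x / y" "\<bar>x / y - 1\<bar> \<le> 4 * h" "x / y \<le> 3"
proof -
  have y: "1 / 2 \<le> y" and x: "1 / 2 \<le> x" using assms by linarith+
  then show "0 < x / y" by simp
  have "\<bar>x / y - 1\<bar> = \<bar>x - y\<bar> / y" using y by (simp add: field_simps abs_if)
  also have "\<dots> \<le> (2 * h) / (1 / 2)"
    using assms y by (intro frac_le) auto
  finally show *: "\<bar>x / y - 1\<bar> \<le> 4 * h" by simp
  then show "x / y \<le> 3" using assms by linarith
qed

section \<open>From the pointwise error to L2 norms\<close>

text \<open>\<open>U\<close> is the transform of the initial value, \<open>d\<close> that of the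
  noise, \<open>e\<close> the filter, and \<open>U * LT - d\<close> the transform of the noisy data.
  With \<open>q\<close> the quotient of the two relative perturbations, the error is U Lt (1 - e q)
  + e q (Lt / LT) d, and 1 - e q = (1 - e) - e (q - 1) separates the filter bias from the error in
  the Mittag-Leffler values.\<close>

lemma regularization_error_pointwise:
  fixes U d :: complex and Lt LT pt pT e h :: real
  assumes L: "0 < Lt" "0 < LT" and h: "h \<le> 1 / 2"
    and pt: "\<bar>(pt - Lt) / Lt\<bar> \<le> h" and pT: "\<bar>(pT - LT) / LT\<bar> \<le> h"
    and e: "0 \<le> e" "e \<le> 1"
  shows "norm (U * of_real Lt - of_real (e * (pt / pT)) * (U * of_real LT - d)) \<le>
    Lt * ((1 - e) + 4 * h) * norm U + 3 * e * (Lt / LT) * norm d"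
proof -
  define q where "q = (pt / Lt) / (pT / LT)"
  have "\<bar>pt / Lt - 1\<bar> \<le> h" "\<bar>pT / LT - 1\<bar> \<le> h"
    using pt pT L by (simp_all add: diff_divide_distrib)
  from relative_error_quotient[OF this h] have q: "0 < q" "\<bar>q - 1\<bar> \<le> 4 * h" "q \<le> 3"
    by (simp_all only: q_def)
  have pq: "pt / pT = q * (Lt / LT)" using L by (simp add: q_def)
  have "U * of_real Lt - of_real (e * (pt / pT)) * (U * of_real LT - d) =
      U * of_real (Lt * (1 - e * q)) + of_real (e * q * (Lt / LT)) * d"
    unfolding pq using L by (simp add: field_simps)
  also have "norm \<dots> \<le> norm U * \<bar>Lt * (1 - e * q)\<bar> + \<bar>e * q * (Lt / LT)\<bar> * norm d"
    by (rule order_trans[OF norm_triangle_ineq]) (simp only: norm_mult norm_of_real order_refl)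
  also have "\<bar>Lt * (1 - e * q)\<bar> = Lt * \<bar>1 - e * q\<bar>" using L by (simp add: abs_mult)
  also have "\<bar>e * q * (Lt / LT)\<bar> = e * q * (Lt / LT)" using L e q by (intro abs_of_nonneg) auto
  also have "norm U * (Lt * \<bar>1 - e * q\<bar>) + e * q * (Lt / LT) * norm d \<le>
      norm U * (Lt * ((1 - e) + 4 * h)) + e * 3 * (Lt / LT) * norm d"
  proof (intro add_mono mult_left_mono mult_right_mono)
    have "1 - e * q = (1 - e) - e * (q - 1)" by (simp add: algebra_simps)
    moreover have "\<bar>e * (q - 1)\<bar> \<le> 1 * (4 * h)"
      unfolding abs_mult using e q by (intro mult_mono) auto
    ultimately show "\<bar>1 - e * q\<bar> \<le> (1 - e) + 4 * h" using e by linarith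
  qed (use L e q in simp_all)
  finally show ?thesis by (simp add: ac_simps)
qed

lemma L2_norm_le_of_pointwise:
  fixes D F1 F2 :: "'a::euclidean_space \<Rightarrow> complex"
  assumes D: "D \<in> borel_measurable borel"
    and F: "square_integrable F1" "square_integrable F2" and c: "0 \<le> c1" "0 \<le> c2"
    and le: "AE x in lborel. norm (D x) \<le> c1 * norm (F1 x) + c2 * norm (F2 x)"
  shows "square_integrable D \<and> L2_norm D \<le> 2 * (c1 * L2_norm F1 + c2 * L2_norm F2)"
proof -
  have [measurable]: "F1 \<in> borel_measurable borel" "F2 \<in> borel_measurable borel"
    using F by (auto simp: square_integrable_iff)
  have sc: "energy (\<lambda>x. complex_of_real (c * norm (G x))) = ennreal ((c * L2_norm G)\<^sup>2)"
    if "square_integrable G" for c and G :: "'a \<Rightarrow> complex"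
  proof -
    have [measurable]: "G \<in> borel_measurable borel" using that by (simp add: square_integrable_iff)
    have "energy (\<lambda>x. complex_of_real (c * norm (G x))) = ennreal (c\<^sup>2) * energy G"
      unfolding energy_def
      by (subst nn_integral_cmult [symmetric]) (auto simp: norm_mult power_mult_distrib ennreal_mult)
    then show ?thesis
      using energy_eq_L2_norm[OF that] by (simp add: power_mult_distrib flip: ennreal_mult)
  qed
  define S where "S = c1 * L2_norm F1 + c2 * L2_norm F2"
  have S: "0 \<le> c1 * L2_norm F1" "0 \<le> c2 * L2_norm F2" using c by (auto simp: L2_norm_def)
  \<comment> \<open>The sum is written as a difference with coefficient \<open>- c2\<close> so that
    \<open>energy_diff_le\<close> applies.\<close>
  have "energy D \<le> energy (\<lambda>x. complex_of_real (c1 * norm (F1 x)) - complex_of_real (- c2 * norm (F2 x)))"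
  proof (rule energy_mono_AE, use le in eventually_elim)
    case (elim x)
    have "norm (complex_of_real (c1 * norm (F1 x)) - complex_of_real (- c2 * norm (F2 x))) =
        \<bar>c1 * norm (F1 x) + c2 * norm (F2 x)\<bar>"
      unfolding of_real_diff [symmetric] norm_of_real by simp
    with elim show ?case by linarith
  qed
  also have "\<dots> \<le> 2 * energy (\<lambda>x. complex_of_real (c1 * norm (F1 x))) + 2 * energy (\<lambda>x. complex_of_real (- c2 * norm (F2 x)))"
    by (rule energy_diff_le) measurable
  also have "\<dots> = ennreal (2 * (c1 * L2_norm F1)\<^sup>2 + 2 * (c2 * L2_norm F2)\<^sup>2)"
    unfolding sc[OF F(1)] sc[OF F(2)] by (simp add: ennreal_mult)
  also have "\<dots> \<le> ennreal ((2 * S)\<^sup>2)"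
  proof (rule ennreal_leI)
    have "0 \<le> (c1 * L2_norm F1)\<^sup>2" "0 \<le> (c2 * L2_norm F2)\<^sup>2"
      "0 \<le> (c1 * L2_norm F1) * (c2 * L2_norm F2)" using S by auto
    moreover have "(2 * S)\<^sup>2 = 4 * (c1 * L2_norm F1)\<^sup>2 + 4 * (c2 * L2_norm F2)\<^sup>2 + 8 * ((c1 * L2_norm F1) * (c2 * L2_norm F2))"
      unfolding S_def by (simp only: power2_eq_square) (simp only: algebra_simps)
    ultimately show "2 * (c1 * L2_norm F1)\<^sup>2 + 2 * (c2 * L2_norm F2)\<^sup>2 \<le> (2 * S)\<^sup>2" by linarith
  qed
  finally have le': "energy D \<le> ennreal ((2 * S)\<^sup>2)" .
  then have sq: "square_integrable D"
    using D by (auto simp: square_integrable_iff intro: le_less_trans)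
  with le' have "ennreal ((L2_norm D)\<^sup>2) \<le> ennreal ((2 * S)\<^sup>2)"
    by (simp only: energy_eq_L2_norm)
  then have "(L2_norm D)\<^sup>2 \<le> (2 * S)\<^sup>2" by (subst (asm) ennreal_le_iff) auto
  then have "L2_norm D \<le> 2 * S"
    by (rule power2_le_imp_le) (use S in \<open>simp add: S_def\<close>)
  with sq show ?thesis by (simp add: S_def)
qed

lemma L2_norm_fourier_le:
  assumes "square_integrable f"
  shows "L2_norm (fourier f) \<le> L2_norm f"
proof -
  have "ennreal ((L2_norm (fourier f))\<^sup>2) \<le> ennreal ((L2_norm f)\<^sup>2)"
    using energy_fourier_le[OF assms] assms
    by (simp add: energy_eq_L2_norm square_integrable_fourier)
  then have "(L2_norm (fourier f))\<^sup>2 \<le> (L2_norm f)\<^sup>2" by (subst (asm) ennreal_le_iff) auto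
  then show ?thesis by (rule power2_le_imp_le) (simp add: L2_norm_def)
qed

section \<open>The error estimate\<close>

text \<open>For \<open>0 < l\<close> some bound on \<delta> / E is necessary: noise at frequencies
  below 1 / \<alpha> passes the filter with a factor of at least exp(-\<tau>), so at h = 0 and t = T
  the error can be of order \<delta>, which exceeds any fixed multiple of E^(l/P) \<delta>^(1 -
  l/P), P = p + 2, once \<delta> / E is large. \<open>C\<close> therefore depends on
  \<open>M\<close>. Membership in the Sobolev space is part of the conclusion because
  \<open>L2_norm\<close> is 0 when its integral diverges.\<close>

theorem theorem4:
  fixes \<gamma> T \<tau> s p M :: real
  assumes "0 < \<gamma>" and "\<gamma> < 1" and "T > 0" and "\<tau> > 0" and "s > 0" and "p > 0"
  shows "\<exists>C>0. \<forall>(E::real) (\<delta>::real) (h::real) (\<psi> :: real \<Rightarrow> real \<Rightarrow> real)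
           (u :: real \<Rightarrow> real ^ 'n \<Rightarrow> complex) (g :: real ^ 'n \<Rightarrow> complex)
           (g\<^sub>\<delta> :: real ^ 'n \<Rightarrow> complex) (v :: real \<Rightarrow> real \<Rightarrow> real ^ 'n \<Rightarrow> complex).
         E > 0 \<and> \<delta> > 0 \<and> 0 \<le> h \<and> h \<le> 1 / 2 \<and>
         final_value_solution \<gamma> T g u \<and>
         in_sobolev p (u 0) \<and> sobolev_norm p (u 0) \<le> E \<and>
         square_integrable g\<^sub>\<delta> \<and> L2_norm (\<lambda>x. g x - g\<^sub>\<delta> x) \<le> \<delta> \<and>
         (\<forall>r\<ge>0. \<forall>t\<in>{0<..T}. \<psi> r t > 0) \<and>
         (\<forall>t\<in>{0<..T}.
            (SUP \<xi> :: real ^ 'n. ennreal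
               \<bar>(\<psi> (norm \<xi>) t - mittag_leffler \<gamma> 1 (- ((norm \<xi>)\<^sup>2 * t powr \<gamma>)))
                 / mittag_leffler \<gamma> 1 (- ((norm \<xi>)\<^sup>2 * t powr \<gamma>))\<bar>) \<le> ennreal h) \<and>
         (\<forall>\<alpha>>0. regularized_solution T \<tau> s \<psi> g\<^sub>\<delta> \<alpha> (v \<alpha>))
         \<longrightarrow>
         (\<forall>t\<in>{0<..T}. \<forall>l\<in>{0..p + 2}. p + 2 - l \<le> s \<and> (0 < l \<longrightarrow> \<delta> \<le> M * E) \<longrightarrow>
            in_sobolev l (\<lambda>x. u t x - v ((h + \<delta> / E) powr (1 / (p + 2))) t x) \<and>
            sobolev_norm l (\<lambda>x. u t x - v ((h + \<delta> / E) powr (1 / (p + 2))) t x)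
              \<le> C / t powr \<gamma> * E powr (l / (p + 2)) * (\<delta> + h * E) powr (1 - l / (p + 2)))"
proof -
  define P where "P = p + 2"
  have P: "0 < P" using assms by (simp add: P_def)
  obtain D1 D2 where D: "0 < D1" "0 < D2"
    and mlf_pos: "\<And>t r. 0 < mittag_leffler \<gamma> 1 (- (r\<^sup>2 * t powr \<gamma>))"
    and mlf_le: "\<And>t r. 0 < t \<Longrightarrow> t \<le> T \<Longrightarrow> mittag_leffler \<gamma> 1 (- (r\<^sup>2 * t powr \<gamma>)) * (1 + r\<^sup>2) \<le> D1 / t powr \<gamma>"
    and mlf_ge: "\<And>r. 1 \<le> D2 * (1 + r\<^sup>2) * mittag_leffler \<gamma> 1 (- (r\<^sup>2 * T powr \<gamma>))"
    using mittag_leffler_two_sided_bounds[of \<gamma> T] assms(1-3) by metis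
  \<comment> \<open>Upper bound for the parameter \<alpha>: \<open>h \<le> 1 / 2\<close> and
    \<delta> / E \<le> M give \<kappa> \<le> 1/2 + |M|.\<close>
  define A where "A = (1 / 2 + \<bar>M\<bar>) powr (1 / P)"
  obtain K where K1: "1 \<le> K"
    and K: "\<And>y. 0 \<le> y \<Longrightarrow> (1 + A\<^sup>2 + y\<^sup>2) powr (P / 2) * exp (- \<tau> * y powr s) \<le> K"
    using bounded_powr_exp[of "1 + A\<^sup>2" \<tau> s "P / 2"] assms by (auto simp: add_pos_nonneg)
  \<comment> \<open>The factor 2 is the loss in \<open>L2_norm_le_of_pointwise\<close>; 5 + \<tau>
    is 1 + \<tau> from the filter bias plus 4 from the relative error; the other summand is the
    noise.\<close>
  define C where "C = 2 * (D1 * (5 + \<tau>) + 3 * D1 * D2 * K)"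
  have C: "0 < C" using D K1 assms by (simp add: C_def add_pos_pos)
  show ?thesis
  proof (intro exI[of _ C] conjI[OF C] allI impI ballI, goal_cases)
    case (1 E \<delta> h \<psi> u g g\<^sub>\<delta> v t l)
    have E: "0 < E" and \<delta>: "0 < \<delta>" and h: "0 \<le> h" "h \<le> 1 / 2"
      and sol: "final_value_solution \<gamma> T g u"
      and u0: "in_sobolev p (u 0)" "sobolev_norm p (u 0) \<le> E"
      and g\<delta>: "square_integrable g\<^sub>\<delta>" "L2_norm (\<lambda>x. g x - g\<^sub>\<delta> x) \<le> \<delta>"
      and SUP_le: "\<forall>t\<in>{0<..T}. (SUP \<xi> :: real ^ 'n. ennreal
               \<bar>(\<psi> (norm \<xi>) t - mittag_leffler \<gamma> 1 (- ((norm \<xi>)\<^sup>2 * t powr \<gamma>)))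
                 / mittag_leffler \<gamma> 1 (- ((norm \<xi>)\<^sup>2 * t powr \<gamma>))\<bar>) \<le> ennreal h"
      and reg: "\<And>\<alpha>. 0 < \<alpha> \<Longrightarrow> regularized_solution T \<tau> s \<psi> g\<^sub>\<delta> \<alpha> (v \<alpha>)"
      using 1(1) by blast+
    have t: "0 < t" "t \<le> T" and l: "0 \<le> l" "l \<le> P" "P - l \<le> s" and lM: "0 < l \<Longrightarrow> \<delta> \<le> M * E"
      using 1(2-4) by (auto simp: P_def)
    define \<kappa> where "\<kappa> = h + \<delta> / E"
    define \<alpha> where "\<alpha> = \<kappa> powr (1 / P)"
    define m where "m = P - l"
    have \<kappa>: "0 < \<kappa>" using E \<delta> h by (simp add: \<kappa>_def add_nonneg_pos)
    have \<alpha>: "0 < \<alpha>" using \<kappa> by (simp add: \<alpha>_def)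
    have m: "0 \<le> m" "m \<le> s" "m / P \<le> 1" using l P by (auto simp: m_def)
    have \<alpha>_powr: "\<alpha> powr x = \<kappa> powr (x / P)" for x by (simp add: \<alpha>_def powr_powr)
    \<comment> \<open>The error in the Mittag-Leffler values must fit the rate \<kappa>^(m/P): since
      h \<le> 1 and m/P \<le> 1, lowering the exponent only increases the power of
      \<open>h\<close>.\<close>
    have h_le: "h \<le> \<kappa> powr (m / P)"
    proof (cases "h = 0")
      case False
      have "h = h powr 1" using h False by simp
      also have "\<dots> \<le> h powr (m / P)" using h False m P by (intro powr_mono') auto
      also have "\<dots> \<le> \<kappa> powr (m / P)"
        using h m P E \<delta> by (intro powr_mono2) (auto simp: \<kappa>_def)
      finally show ?thesis .
    qed simp
    have err: "\<bar>(\<psi> (norm \<xi>) t' - mittag_leffler \<gamma> 1 (- ((norm \<xi>)\<^sup>2 * t' powr \<gamma>)))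
        / mittag_leffler \<gamma> 1 (- ((norm \<xi>)\<^sup>2 * t' powr \<gamma>))\<bar> \<le> h"
      if t': "0 < t'" "t' \<le> T" for t' and \<xi> :: "real ^ 'n"
    proof -
      have "t' \<in> {0<..T}" using t' by simp
      from order_trans[OF SUP_upper[OF UNIV_I] bspec[OF SUP_le this], of \<xi>] show ?thesis
        using h by (subst (asm) ennreal_le_iff) auto
    qed
    have filter: "(1 + r\<^sup>2) powr (l / 2) * exp (- \<tau> * (\<alpha> * r) powr s) \<le> K * \<kappa> powr (- l / P)"
      if r: "0 \<le> r" for r
    \<comment> \<open>At \<open>l = 0\<close> nothing bounds \<alpha> by \<open>A\<close>, but there
      the weight is 1 and the filter is at most \<open>1 \<le> K\<close>.\<close>
    proof (cases "l = 0")
      case True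
      have "0 < 1 + r\<^sup>2" by (intro add_pos_nonneg) auto
      moreover have "exp (- \<tau> * (\<alpha> * r) powr s) \<le> K"
        using assms by (intro order_trans[OF _ K1]) simp
      ultimately show ?thesis using True \<kappa> by simp
    next
      case False
      then have "\<delta> / E \<le> M" using lM l E by (simp add: pos_divide_le_eq)
      then have "\<kappa> \<le> 1 / 2 + \<bar>M\<bar>" using h by (simp add: \<kappa>_def)
      then have "\<alpha> \<le> A" unfolding \<alpha>_def A_def using \<kappa> P by (intro powr_mono2) auto
      from exp_filter_bound[OF K l(1,2) \<alpha> this r] show ?thesis by (simp add: \<alpha>_powr)
    qed
    define c1 where "c1 = D1 / t powr \<gamma> * ((5 + \<tau>) * \<kappa> powr (m / P))"
    define c2 where "c2 = 3 * (D1 * D2 / t powr \<gamma>) * (K * \<kappa> powr (- l / P))"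
    have c: "0 \<le> c1" "0 \<le> c2" using D K1 assms by (auto simp: c1_def c2_def)
    let ?L = "\<lambda>r t. mittag_leffler \<gamma> 1 (- (r\<^sup>2 * t powr \<gamma>))"
    let ?e = "\<lambda>r. exp (- \<tau> * (\<alpha> * r) powr s)"
    have weight1: "(1 + r\<^sup>2) powr (l / 2) * (?L r t * ((1 - ?e r) + 4 * h)) \<le> c1 * (1 + r\<^sup>2) powr (p / 2)"
      if r: "0 \<le> r" for r
    proof -
      have pos: "1 \<le> 1 + r\<^sup>2" "0 < 1 + r\<^sup>2" by (auto intro: add_pos_nonneg)
      \<comment> \<open>The exponent is split as l = 2 + p - m: two derivatives are absorbed by the
        Mittag-Leffler factor, p go to the norm of the initial value, and -m compensates the
        filter.\<close>
      have "(1 + r\<^sup>2) powr (l / 2) = (1 + r\<^sup>2) powr (1 + (p / 2 + - m / 2))"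
        by (rule arg_cong[where f = "(powr) _"]) (simp add: m_def P_def field_simps)
      also have "\<dots> = (1 + r\<^sup>2) * ((1 + r\<^sup>2) powr (p / 2) * (1 + r\<^sup>2) powr (- m / 2))"
        using pos by (simp only: powr_add powr_one)
      finally have "(1 + r\<^sup>2) powr (l / 2) * (?L r t * ((1 - ?e r) + 4 * h)) =
          (?L r t * (1 + r\<^sup>2)) * ((1 + r\<^sup>2) powr (- m / 2) * ((1 - ?e r) + 4 * h)) * (1 + r\<^sup>2) powr (p / 2)"
        by (simp only: ac_simps)
      also have "\<dots> \<le> D1 / t powr \<gamma> * ((5 + \<tau>) * \<kappa> powr (m / P)) * (1 + r\<^sup>2) powr (p / 2)"
      proof (rule mult_right_mono[OF mult_mono])
        show "?L r t * (1 + r\<^sup>2) \<le> D1 / t powr \<gamma>" using t by (rule mlf_le)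
        have "(1 + r\<^sup>2) powr (- m / 2) * (1 - ?e r) \<le> (1 + \<tau>) * \<kappa> powr (m / P)"
          using one_minus_exp_filter_bound[of \<tau> s m \<alpha> r] assms m \<alpha> r by (simp add: \<alpha>_powr)
        moreover have "(1 + r\<^sup>2) powr (- m / 2) * (4 * h) \<le> 1 * (4 * \<kappa> powr (m / P))"
        proof (intro mult_mono)
          have "(1 + r\<^sup>2) powr (- m / 2) \<le> (1 + r\<^sup>2) powr 0" using pos m by (intro powr_mono) auto
          then show "(1 + r\<^sup>2) powr (- m / 2) \<le> 1" using pos by simp
        qed (use h h_le in auto)
        moreover have "(5 + \<tau>) * \<kappa> powr (m / P) = (1 + \<tau>) * \<kappa> powr (m / P) + 1 * (4 * \<kappa> powr (m / P))"
          by (simp add: algebra_simps)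
        ultimately show "(1 + r\<^sup>2) powr (- m / 2) * ((1 - ?e r) + 4 * h) \<le> (5 + \<tau>) * \<kappa> powr (m / P)"
          unfolding distrib_left by linarith
      qed (use D t h assms in auto)
      finally show ?thesis by (simp add: c1_def)
    qed
    have weight2: "(1 + r\<^sup>2) powr (l / 2) * (3 * ?e r * (?L r t / ?L r T)) \<le> c2" if r: "0 \<le> r" for r
    proof -
      \<comment> \<open>The two derivatives lost in dividing by the value at \<open>T\<close> are
        those gained by the value at \<open>t\<close>.\<close>
      have "?L r t * 1 \<le> ?L r t * (D2 * (1 + r\<^sup>2) * ?L r T)"
        using mlf_ge[of r] mlf_pos[of r t] by (intro mult_left_mono) auto
      also have "\<dots> = D2 * ?L r T * (?L r t * (1 + r\<^sup>2))" by (simp only: ac_simps)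
      also have "\<dots> \<le> D2 * ?L r T * (D1 / t powr \<gamma>)"
        using mlf_le[OF t, of r] D mlf_pos[of r T] by (intro mult_left_mono) auto
      finally have "?L r t / ?L r T \<le> D1 * D2 / t powr \<gamma>"
        using mlf_pos[of r T] by (simp add: pos_divide_le_eq ac_simps)
      then have "3 * (?L r t / ?L r T) \<le> 3 * (D1 * D2 / t powr \<gamma>)" by simp
      then have "3 * (?L r t / ?L r T) * ((1 + r\<^sup>2) powr (l / 2) * ?e r) \<le> c2"
        unfolding c2_def by (rule mult_mono[OF _ filter[OF r]]) (use D in auto)
      then show ?thesis by (simp only: ac_simps)
    qed
    have sq_u: "square_integrable (u t')" if "0 \<le> t'" "t' \<le> T" for t'
      using sol that by (simp add: final_value_solution_def)
    have hat_u: "AE \<xi> in lborel. fourier (u t') \<xi> = fourier (u 0) \<xi> * complex_of_real (?L (norm \<xi>) t')"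
      if "0 \<le> t'" "t' \<le> T" for t'
      using sol that by (simp add: final_value_solution_def)
    have sq_v: "square_integrable (v \<alpha> t)"
      and hat_v: "AE \<xi> in lborel. fourier (v \<alpha> t) \<xi> =
           complex_of_real (?e (norm \<xi>) * (\<psi> (norm \<xi>) t / \<psi> (norm \<xi>) T)) * fourier g\<^sub>\<delta> \<xi>"
      using reg[OF \<alpha>] t by (simp_all add: regularized_solution_def)
    define w where "w = (\<lambda>x. u t x - v \<alpha> t x)"
    define d where "d = (\<lambda>x. g x - g\<^sub>\<delta> x)"
    have sq_w: "square_integrable w"
      unfolding w_def using t by (intro square_integrable_diff sq_u sq_v) auto
    have sq_d: "square_integrable d"
      unfolding d_def using sol g\<delta> by (intro square_integrable_diff) (auto simp: final_value_solution_def)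
    have hat_w: "AE \<xi> in lborel. fourier w \<xi> = fourier (u t) \<xi> - fourier (v \<alpha> t) \<xi>"
      using t by (intro fourier_diff sq_u sq_v sq_w) (auto simp: w_def)
    have hat_d: "AE \<xi> in lborel. fourier d \<xi> = fourier (u T) \<xi> - fourier g\<^sub>\<delta> \<xi>"
    proof (intro fourier_diff sq_u g\<delta> sq_d)
      show "AE x in lborel. d x = u T x - g\<^sub>\<delta> x"
        using sol unfolding final_value_solution_def d_def by (auto elim!: eventually_mono)
    qed (use assms in auto)
    have "AE \<xi> in lborel. norm (sobolev_weighted l w \<xi>) \<le>
        c1 * norm (sobolev_weighted p (u 0) \<xi>) + c2 * norm (fourier d \<xi>)"
      using hat_u[of t, OF less_imp_le[OF t(1)] t(2)] hat_u[of T, OF less_imp_le[OF assms(3)] order_refl]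
        hat_v hat_w hat_d
    proof eventually_elim
      case (elim \<xi>)
      let ?r = "norm \<xi>"
      have g\<delta>_eq: "fourier g\<^sub>\<delta> \<xi> = fourier (u 0) \<xi> * complex_of_real (?L ?r T) - fourier d \<xi>"
        using elim(2,5) by simp
      have "norm (fourier w \<xi>) \<le> ?L ?r t * ((1 - ?e ?r) + 4 * h) * norm (fourier (u 0) \<xi>) +
          3 * ?e ?r * (?L ?r t / ?L ?r T) * norm (fourier d \<xi>)"
        unfolding elim(4) elim(1) elim(3) g\<delta>_eq
        by (rule regularization_error_pointwise[OF mlf_pos mlf_pos h(2) err[OF t] err[OF assms(3) order_refl]])
           (use assms in auto)
      then have "(1 + ?r\<^sup>2) powr (l / 2) * norm (fourier w \<xi>) \<le> (1 + ?r\<^sup>2) powr (l / 2) *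
          (?L ?r t * ((1 - ?e ?r) + 4 * h) * norm (fourier (u 0) \<xi>) +
          3 * ?e ?r * (?L ?r t / ?L ?r T) * norm (fourier d \<xi>))"
        by (rule mult_left_mono) simp
      also have "\<dots> = (1 + ?r\<^sup>2) powr (l / 2) * (?L ?r t * ((1 - ?e ?r) + 4 * h)) * norm (fourier (u 0) \<xi>) +
          (1 + ?r\<^sup>2) powr (l / 2) * (3 * ?e ?r * (?L ?r t / ?L ?r T)) * norm (fourier d \<xi>)"
        by (simp only: distrib_left distrib_right mult.assoc)
      also have "\<dots> \<le> c1 * (1 + ?r\<^sup>2) powr (p / 2) * norm (fourier (u 0) \<xi>) + c2 * norm (fourier d \<xi>)"
        by (intro add_mono mult_right_mono weight1 weight2) auto
      finally show ?case
        by (simp add: sobolev_weighted_def norm_mult mult.assoc)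
    qed
    moreover have "sobolev_weighted l w \<in> borel_measurable borel"
    proof -
      have [measurable]: "fourier w \<in> borel_measurable borel"
        using square_integrable_fourier[OF sq_w] by (simp add: square_integrable_iff)
      show ?thesis unfolding sobolev_weighted_def[abs_def] by measurable
    qed
    moreover have "square_integrable (sobolev_weighted p (u 0))" "square_integrable (fourier d)"
      using u0 square_integrable_fourier[OF sq_d] by (auto simp: in_sobolev_def)
    ultimately have main: "square_integrable (sobolev_weighted l w)"
      "L2_norm (sobolev_weighted l w) \<le>
        2 * (c1 * L2_norm (sobolev_weighted p (u 0)) + c2 * L2_norm (fourier d))"
      using L2_norm_le_of_pointwise c by blast+
    \<comment> \<open>The common size of all error terms: the noise part is at most E \<kappa>
      \<kappa>^(-l/P), which equals \<open>Q\<close> because 1 - l/P = m/P.\<close>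
    define Q where "Q = E * \<kappa> powr (m / P)"
    have Q_eq: "Q = E powr (l / P) * (\<delta> + h * E) powr (1 - l / P)"
    proof -
      have mP: "m / P = 1 - l / P" using P by (simp add: m_def diff_divide_distrib)
      have "\<delta> + h * E = E * \<kappa>" using E by (simp add: \<kappa>_def field_simps)
      then have "E powr (l / P) * (\<delta> + h * E) powr (1 - l / P) =
          (E powr (l / P) * E powr (1 - l / P)) * \<kappa> powr (1 - l / P)"
        using E \<kappa> by (simp add: powr_mult)
      also have "E powr (l / P) * E powr (1 - l / P) = E"
        using E by (simp flip: powr_add)
      finally show ?thesis by (simp add: Q_def mP)
    qed
    have "c1 * L2_norm (sobolev_weighted p (u 0)) \<le> c1 * E"
      using u0 c by (intro mult_left_mono) (auto simp: sobolev_norm_def)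
    also have "c1 * E = D1 * (5 + \<tau>) / t powr \<gamma> * Q" by (simp add: c1_def Q_def)
    finally have b1: "c1 * L2_norm (sobolev_weighted p (u 0)) \<le> D1 * (5 + \<tau>) / t powr \<gamma> * Q" .
    have "L2_norm (fourier d) \<le> E * \<kappa>"
    proof -
      have "L2_norm (fourier d) \<le> \<delta>"
        using L2_norm_fourier_le[OF sq_d] g\<delta> by (simp add: d_def)
      also have "\<delta> \<le> E * \<kappa>" using E h by (simp add: \<kappa>_def distrib_left)
      finally show ?thesis .
    qed
    then have "c2 * L2_norm (fourier d) \<le> c2 * (E * \<kappa>)"
      using c by (intro mult_left_mono) auto
    also have "\<dots> = 3 * D1 * D2 * K / t powr \<gamma> * (E * (\<kappa> powr (- l / P) * \<kappa> powr 1))"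
      using \<kappa> by (simp add: c2_def)
    also have "\<kappa> powr (- l / P) * \<kappa> powr 1 = \<kappa> powr (m / P)"
      unfolding powr_add [symmetric] using P by (simp add: m_def diff_divide_distrib)
    finally have b2: "c2 * L2_norm (fourier d) \<le> 3 * D1 * D2 * K / t powr \<gamma> * Q"
      by (simp add: Q_def)
    note main(2)
    also have "2 * (c1 * L2_norm (sobolev_weighted p (u 0)) + c2 * L2_norm (fourier d)) \<le>
        2 * (D1 * (5 + \<tau>) / t powr \<gamma> * Q + 3 * D1 * D2 * K / t powr \<gamma> * Q)"
      using b1 b2 by (intro mult_left_mono add_mono) auto
    also have "\<dots> = C / t powr \<gamma> * Q"
      by (simp add: C_def add_divide_distrib distrib_right distrib_left)
    finally have "L2_norm (sobolev_weighted l w) \<le> C / t powr \<gamma> * Q" .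
    then have "in_sobolev l w \<and> sobolev_norm l w \<le> C / t powr \<gamma> * E powr (l / P) * (\<delta> + h * E) powr (1 - l / P)"
      using sq_w main(1) by (simp add: in_sobolev_def sobolev_norm_def Q_eq mult.assoc)
    then show ?case
      unfolding w_def \<alpha>_def \<kappa>_def P_def .
  qed
qed

end
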